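(* For every $\varepsilon>0$, $c>0$ and $K\ge 0$ there is a constant $C=C(\varepsilon,c,K)>0$ such that the following holds for every integer $n\ge 1$. Let $d\mu(x)=e^{-v(x)}\,dx$ be a probability measure on $\mathbb{R}$, with $v:\mathbb{R}\to\mathbb{R}$ twice continuously differentiable and $v''(x)\ge c$ for all $x\in\mathbb{R}$. Let $f:\mathbb{R}^n\to\mathbb{R}$ be a $C^1$ function with $f\in L^2(\mu^{\otimes n})$ and total influence $I(f)\le K$. Then there exists a function $g:\mathbb{R}^n\to\mathbb{R}$ which depends on at most $C$ coordinates and satisfies $$\|f-g\|_{L^1(\mu^{\otimes n})}\le \varepsilon .$$
   Context: $\mu^{\otimes n}$ is the $n$-fold product measure on $\mathbb{R}^n$. For a $C^1$ function $f:\mathbb{R}^n\to\mathbb{R}$, the total (geometric) influence is $I(f)=\sum_{i=1}^n\|\partial_i f\|_{L^1(\mu^{\otimes n})}$. A function $g$ on $\mathbb{R}^n$ depends on at most $C$ coordinates if there is a set $J\subset\{1,\dots,n\}$ with $|J|\le C$ such that $g(x)$ is a function of $(x_i)_{i\in J}$ only. *)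

theory Defs
  imports "HOL-Probability.Probability"
begin

definition twice_cont_diff :: "(real \<Rightarrow> real) \<Rightarrow> bool" where
  "twice_cont_diff v \<longleftrightarrow>
     (\<forall>x. v differentiable (at x)) \<and>
     (\<forall>x. deriv v differentiable (at x)) \<and>
     continuous_on UNIV (deriv (deriv v))"

definition exp_density_measure :: "(real \<Rightarrow> real) \<Rightarrow> real measure" where
  "exp_density_measure v = density lborel (\<lambda>x. ennreal (exp (- v x)))"

text \<open>
  Since the dimension \<open>n\<close> is quantified inside the statement, a point of n-space is an
  extensional function on \<open>{1..n}\<close>. Functions on n-space have type
  \<open>(nat \<Rightarrow> real) \<Rightarrow> real\<close>; their values outside \<open>Rn n\<close> never matter.
\<close>

definition Rn :: "nat \<Rightarrow> (nat \<Rightarrow> real) set" where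
  "Rn n = (\<Pi>\<^sub>E i\<in>{1..n}. UNIV)"

definition product_power :: "nat \<Rightarrow> real measure \<Rightarrow> (nat \<Rightarrow> real) measure" where
  "product_power n \<mu> = (\<Pi>\<^sub>M i\<in>{1..n}. \<mu>)"

definition partial_deriv :: "nat \<Rightarrow> ((nat \<Rightarrow> real) \<Rightarrow> real) \<Rightarrow> (nat \<Rightarrow> real) \<Rightarrow> real" where
  "partial_deriv i f x = deriv (\<lambda>t. f (x(i := t))) (x i)"

text \<open>
  Continuity refers to the topology of pointwise convergence on \<open>nat \<Rightarrow> real\<close>, which
  induces the Euclidean topology on \<open>Rn n\<close>.
\<close>

definition C1_on_Rn :: "nat \<Rightarrow> ((nat \<Rightarrow> real) \<Rightarrow> real) \<Rightarrow> bool" where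
  "C1_on_Rn n f \<longleftrightarrow>
     continuous_on (Rn n) f \<and>
     (\<forall>i\<in>{1..n}.
        (\<forall>x\<in>Rn n. (\<lambda>t. f (x(i := t))) differentiable (at (x i))) \<and>
        continuous_on (Rn n) (partial_deriv i f))"

definition in_L2 :: "'a measure \<Rightarrow> ('a \<Rightarrow> real) \<Rightarrow> bool" where
  "in_L2 M f \<longleftrightarrow> f \<in> borel_measurable M \<and> integrable M (\<lambda>x. (f x)\<^sup>2)"

text \<open>The norm takes values in \<open>ennreal\<close>, so a non-integrable function has norm \<open>\<infinity>\<close>.\<close>

definition L1_norm :: "'a measure \<Rightarrow> ('a \<Rightarrow> real) \<Rightarrow> ennreal" where
  "L1_norm M f = (\<integral>\<^sup>+x. ennreal \<bar>f x\<bar> \<partial>M)"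

definition total_influence :: "nat \<Rightarrow> real measure \<Rightarrow> ((nat \<Rightarrow> real) \<Rightarrow> real) \<Rightarrow> ennreal" where
  "total_influence n \<mu> f = (\<Sum>i=1..n. L1_norm (product_power n \<mu>) (partial_deriv i f))"

definition depends_on_at_most :: "nat \<Rightarrow> real \<Rightarrow> ((nat \<Rightarrow> real) \<Rightarrow> real) \<Rightarrow> bool" where
  "depends_on_at_most n C g \<longleftrightarrow>
     (\<exists>J\<subseteq>{1..n}. real (card J) \<le> C \<and>
        (\<forall>x\<in>Rn n. \<forall>y\<in>Rn n. (\<forall>i\<in>J. x i = y i) \<longrightarrow> g x = g y))"

end

(*
  Cutting the line into m cells of equal mass and averaging f over the cells, one coordinate
  after the other, costs at most 2 kappa(m) times the total influence in L1. Strong convexity of v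
  makes kappa(m) tend to 0 uniformly in v: at every point a tail is small compared with the density,
  or the density is bounded below. This reduces the problem to functions F on a grid with m^n points,
  whose resampling influences are still bounded.

  On the grid a logarithmic Sobolev inequality holds with a constant depending only on m, and gives
  E h^2 <= s (energy of h) + beta(s) (E |h|)^2 for every s > 0. Since F is not bounded, this is applied
  to the martingale differences, along the coordinates of small influence, of G = quad_inv (F - E F)
  instead of F: because |G(x) - G(y)|^2 <= 2 |F(x) - F(y)|, the energy of G is bounded by the L1
  influences of F, and because quad_inv is 1-Lipschitz the L1 influences of G are not larger than those
  of F. Hence G is close in L2 to a conditional expectation W depending on few coordinates only, and as
  quad has quadratic growth, F is close in L1 to quad W + E F.
*)
theory Submission
  imports Defs
begin

text \<open>An L1 bound on partial derivatives says nothing about the square of a gradient, but the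
  energy on a grid is built from differences, and squared differences of G are dominated by
  differences of F; this is why a grid is needed. The free parameter s is what makes the error
  small. A Poincare inequality alone would leave the energy, of order K, with a fixed factor. With s
  small this term is small, and its price beta(s) only multiplies the sum of the squared L1
  influences over coordinates of influence at most \<delta>, hence at most \<delta> K; so \<delta>
  is chosen after s, and at most K / \<delta> coordinates exceed it. The measure enters only through
  \<open>cell_constant\<close>, used twice: with m cells and a small constant for the discretization
  error, and with a single cell and a merely bounded constant to turn derivatives into resampling
  influences. Both constants depend on c, \<epsilon>, K alone, and so do m, s and \<delta>; this
  keeps C independent of v and n.\<close>

text \<open>Inserting \<open>ln t \<le> t - 1\<close> at t = h^2 / A bounds the entropy by Var(h^2)
  / A. A variance is the least mean square distance to a constant, so e^2 may replace the mean of
  h^2, and h^2 - e^2 factors as (h - e)(h + e). The second factor is bounded because an atom of mass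
  1/m forces h^2 <= m A.\<close>

lemma entropy_le_variance:
  fixes h :: "nat \<Rightarrow> real"
  assumes m: "m > 0"
  defines "E \<equiv> \<lambda>u. (\<Sum>a<m. u a) / real m"
  shows "E (\<lambda>a. (h a)\<^sup>2 * ln ((h a)\<^sup>2)) - E (\<lambda>a. (h a)\<^sup>2) * ln (E (\<lambda>a. (h a)\<^sup>2))
    \<le> 2 * (real m + 1) * (E (\<lambda>a. (h a)\<^sup>2) - (E h)\<^sup>2)"
proof -
  define A where "A = E (\<lambda>a. (h a)\<^sup>2)"
  define e where "e = E h"
  have E_lin: "E (\<lambda>a. s * u a + t * w a + r) = s * E u + t * E w + r" for s t r u w
    using m by (simp add: E_def sum.distrib sum_distrib_left[symmetric] field_simps)
  have E_mono: "E u \<le> E w" if "\<And>a. a < m \<Longrightarrow> u a \<le> w a" for u w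
    unfolding E_def using that by (intro divide_right_mono sum_mono) auto
  have E_nn: "0 \<le> E u" if "\<And>a. a < m \<Longrightarrow> 0 \<le> u a" for u
    unfolding E_def using that by (intro divide_nonneg_nonneg sum_nonneg) auto
  have var: "E (\<lambda>a. (h a - e)\<^sup>2) = A - e\<^sup>2"
  proof -
    have "E (\<lambda>a. (h a - e)\<^sup>2) = E (\<lambda>a. 1 * (h a)\<^sup>2 + (- 2 * e) * h a + e\<^sup>2)"
      by (intro arg_cong[of _ _ E] ext) (simp add: power2_eq_square algebra_simps)
    also have "\<dots> = A - e\<^sup>2"
      unfolding E_lin A_def[symmetric] e_def[symmetric] by (simp add: power2_eq_square)
    finally show ?thesis .
  qed
  have A_nn: "0 \<le> A" and eA: "e\<^sup>2 \<le> A"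
    using E_nn[of "\<lambda>a. (h a)\<^sup>2"] E_nn[of "\<lambda>a. (h a - e)\<^sup>2"] var by (auto simp: A_def)
  show ?thesis
  proof (cases "A = 0")
    case True
    have "(\<Sum>a<m. (h a)\<^sup>2) = 0" using True m by (simp add: A_def E_def)
    then have "\<And>a. a < m \<Longrightarrow> h a = 0" by (subst (asm) sum_nonneg_eq_0_iff) auto
    then show ?thesis by (simp add: E_def)
  next
    case False
    then have A: "A > 0" using A_nn by simp
    have hm: "(h a)\<^sup>2 \<le> m * A" if "a < m" for a
    proof -
      have "(h a)\<^sup>2 \<le> (\<Sum>a<m. (h a)\<^sup>2)" using that by (intro member_le_sum) auto
      then show ?thesis using m by (simp add: A_def E_def)
    qed
    have ln_le: "(h a)\<^sup>2 * ln ((h a)\<^sup>2) \<le> (1 / A) * (h a) ^ 4 + (ln A - 1) * (h a)\<^sup>2 + 0" for a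
    proof (cases "h a = 0")
      case False
      then have "ln ((h a)\<^sup>2 / A) \<le> (h a)\<^sup>2 / A - 1" using A by (intro ln_le_minus_one) auto
      then have "ln ((h a)\<^sup>2) \<le> (h a)\<^sup>2 / A - 1 + ln A" using A False by (subst (asm) ln_div) auto
      then have "(h a)\<^sup>2 * ln ((h a)\<^sup>2) \<le> (h a)\<^sup>2 * ((h a)\<^sup>2 / A - 1 + ln A)" by (intro mult_left_mono) auto
      also have "\<dots> = (1 / A) * (h a) ^ 4 + (ln A - 1) * (h a)\<^sup>2 + 0"
        by (simp add: power4_eq_xxxx power2_eq_square algebra_simps)
      finally show ?thesis .
    qed simp
    have "E (\<lambda>a. (h a)\<^sup>2 * ln ((h a)\<^sup>2)) - A * ln A \<le> (1 / A) * E (\<lambda>a. h a ^ 4) - A"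
      using E_mono[OF ln_le] unfolding E_lin by (simp add: A_def algebra_simps)
    also have "\<dots> = (1 / A) * (E (\<lambda>a. h a ^ 4) - A\<^sup>2)" using A by (simp add: field_simps power2_eq_square)
    also have "\<dots> \<le> (1 / A) * E (\<lambda>a. ((h a)\<^sup>2 - e\<^sup>2)\<^sup>2)"
    proof -
      have "E (\<lambda>a. ((h a)\<^sup>2 - e\<^sup>2)\<^sup>2) = E (\<lambda>a. 1 * h a ^ 4 + (- 2 * e\<^sup>2) * (h a)\<^sup>2 + e ^ 4)"
        by (intro arg_cong[of _ _ E] ext) (simp add: power2_eq_square power4_eq_xxxx algebra_simps)
      also have "\<dots> = E (\<lambda>a. h a ^ 4) - A\<^sup>2 + (A - e\<^sup>2)\<^sup>2"
        unfolding E_lin A_def[symmetric] by (simp add: power2_eq_square power4_eq_xxxx algebra_simps)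
      finally have "E (\<lambda>a. h a ^ 4) - A\<^sup>2 \<le> E (\<lambda>a. ((h a)\<^sup>2 - e\<^sup>2)\<^sup>2)" by simp
      then show ?thesis using A by (intro mult_left_mono) auto
    qed
    also have "\<dots> \<le> (1 / A) * E (\<lambda>a. (2 * (m + 1) * A) * (h a - e)\<^sup>2 + 0 * 0 + 0)"
    proof (intro mult_left_mono E_mono)
      fix a assume "a < m"
      have "((h a)\<^sup>2 - e\<^sup>2)\<^sup>2 = (h a + e)\<^sup>2 * (h a - e)\<^sup>2" by (simp add: power2_eq_square algebra_simps)
      also have "\<dots> \<le> (2 * (m + 1) * A) * (h a - e)\<^sup>2"
      proof (intro mult_right_mono)
        have "(h a + e)\<^sup>2 \<le> 2 * (h a)\<^sup>2 + 2 * e\<^sup>2"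
          using zero_le_power2[of "h a - e"] by (simp add: power2_eq_square algebra_simps)
        also have "\<dots> \<le> 2 * (m * A) + 2 * A" using hm[OF \<open>a < m\<close>] eA by linarith
        finally show "(h a + e)\<^sup>2 \<le> 2 * (m + 1) * A" by (simp add: algebra_simps)
      qed auto
      finally show "((h a)\<^sup>2 - e\<^sup>2)\<^sup>2 \<le> (2 * (m + 1) * A) * (h a - e)\<^sup>2 + 0 * 0 + 0" by simp
    qed (use A in auto)
    also have "\<dots> = 2 * (real m + 1) * (A - e\<^sup>2)" unfolding E_lin var using A by simp
    finally show ?thesis unfolding A_def e_def .
  qed
qed

section \<open>The logarithmic Sobolev inequality on a finite grid\<close>

locale grid =
  fixes m :: nat
  assumes m_pos: "m > 0"
begin

text \<open>No finite product measure is formed: \<open>av i\<close> is the conditional expectation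
  that forgets coordinate i, acting on functions of all coordinates. The expectation is
  \<open>avgs L F x\<close>, where x matters only off \<open>L\<close>; everything holds with those
  coordinates frozen.\<close>

definition av :: "'i \<Rightarrow> (('i \<Rightarrow> nat) \<Rightarrow> real) \<Rightarrow> ('i \<Rightarrow> nat) \<Rightarrow> real" where
  "av i F x = (\<Sum>a<m. F (x(i := a))) / real m"

definition avgs :: "'i list \<Rightarrow> (('i \<Rightarrow> nat) \<Rightarrow> real) \<Rightarrow> ('i \<Rightarrow> nat) \<Rightarrow> real" where
  "avgs L = foldr av L"

definition var :: "'i \<Rightarrow> (('i \<Rightarrow> nat) \<Rightarrow> real) \<Rightarrow> ('i \<Rightarrow> nat) \<Rightarrow> real" where
  "var i F x = av i (\<lambda>y. (F y)\<^sup>2) x - (av i F x)\<^sup>2"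

lemma avgs_Nil [simp]: "avgs [] F = F"
  and avgs_Cons [simp]: "avgs (i # L) F = av i (avgs L F)"
  by (simp_all add: avgs_def)

lemma av_add: "av i (\<lambda>y. F y + G y) x = av i F x + av i G x"
  by (simp add: av_def sum.distrib add_divide_distrib)

lemma av_diff: "av i (\<lambda>y. F y - G y) x = av i F x - av i G x"
  by (simp add: av_def sum_subtractf diff_divide_distrib)

lemma av_cmult: "av i (\<lambda>y. c * F y) x = c * av i F x"
  by (simp add: av_def sum_distrib_left)

lemma av_sum: "av i (\<lambda>y. \<Sum>k\<in>S. F k y) x = (\<Sum>k\<in>S. av i (F k) x)"
  unfolding av_def by (subst sum.swap) (simp add: sum_divide_distrib)

lemma av_const [simp]: "av i (\<lambda>y. c) x = c"
  using m_pos by (simp add: av_def)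

lemma av_mono: "(\<And>a. a < m \<Longrightarrow> F (x(i := a)) \<le> G (x(i := a))) \<Longrightarrow> av i F x \<le> av i G x"
  unfolding av_def by (intro divide_right_mono sum_mono) auto

lemma abs_av_le: "\<bar>av i F x\<bar> \<le> av i (\<lambda>y. \<bar>F y\<bar>) x"
  unfolding av_def by (simp add: abs_divide divide_right_mono)

lemma av_upd [simp]: "av i F (x(i := a)) = av i F x"
  by (simp add: av_def)

lemma av_mult: "(\<And>a. G (x(i := a)) = G x) \<Longrightarrow> av i (\<lambda>y. G y * F y) x = G x * av i F x"
  by (simp add: av_def sum_distrib_left)

lemma av_idem [simp]: "av i (av i F) = av i F"
proof
  show "av i (av i F) x = av i F x" for x using m_pos by (simp add: av_def[of i "av i F"])
qed

lemma av_commute: "av i (av j F) = av j (av i F)"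
proof (cases "i = j")
  case False
  show ?thesis
  proof
    show "av i (av j F) x = av j (av i F) x" for x
      unfolding av_def sum_divide_distrib using False by (subst sum.swap) (simp add: fun_upd_twist)
  qed
qed simp

lemma avgs_av: "avgs L (av i F) = av i (avgs L F)"
  by (induction L) (auto simp: av_commute)

lemma avgs_absorb: "i \<in> set L \<Longrightarrow> avgs L (av i F) = avgs L F"
proof (induction L)
  case (Cons j L)
  show ?case
  proof (cases "i = j")
    case False
    then show ?thesis using Cons by simp
  qed (simp add: avgs_av)
qed simp

lemma avgs_avgs_absorb: "set P \<subseteq> set L \<Longrightarrow> avgs L (avgs P F) = avgs L F"
  by (induction P) (auto simp: avgs_absorb)

lemma avgs_add: "avgs L (\<lambda>y. F y + G y) x = avgs L F x + avgs L G x"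
proof (induction L arbitrary: x)
  case (Cons i L)
  then have "avgs L (\<lambda>y. F y + G y) = (\<lambda>x. avgs L F x + avgs L G x)" by blast
  then show ?case by (simp add: av_add)
qed simp

lemma avgs_cmult: "avgs L (\<lambda>y. c * F y) x = c * avgs L F x"
proof (induction L arbitrary: x)
  case (Cons i L)
  then have "avgs L (\<lambda>y. c * F y) = (\<lambda>x. c * avgs L F x)" by blast
  then show ?case by (simp add: av_cmult)
qed simp

lemma avgs_diff: "avgs L (\<lambda>y. F y - G y) x = avgs L F x - avgs L G x"
  using avgs_add[of L F "\<lambda>y. - 1 * G y" x] by (simp only: avgs_cmult) simp

lemma avgs_const [simp]: "avgs L (\<lambda>y. c) x = c"
proof (induction L arbitrary: x)
  case (Cons i L)
  then have "avgs L (\<lambda>y. c) = (\<lambda>x. c)" by blast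
  then show ?case by simp
qed simp

lemma avgs_sum: "finite S \<Longrightarrow> avgs L (\<lambda>y. \<Sum>k\<in>S. F k y) x = (\<Sum>k\<in>S. avgs L (F k) x)"
  by (induction S rule: finite_induct) (simp_all add: avgs_add)

lemma avgs_mono':
  assumes "\<And>y. (\<And>i. i \<notin> set L \<Longrightarrow> y i = x i) \<Longrightarrow> F y \<le> G y"
  shows "avgs L F x \<le> avgs L G x"
  using assms
proof (induction L arbitrary: x)
  case (Cons i L)
  have "avgs L F (x(i := a)) \<le> avgs L G (x(i := a))" for a
    by (rule Cons.IH, rule Cons.prems) auto
  then show ?case unfolding avgs_Cons by (intro av_mono)
qed simp

lemma avgs_mono: "(\<And>y. F y \<le> G y) \<Longrightarrow> avgs L F x \<le> avgs L G x"
  by (rule avgs_mono')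

lemma avgs_nonneg: "(\<And>y. 0 \<le> F y) \<Longrightarrow> 0 \<le> avgs L F x"
  using avgs_mono[of "\<lambda>y. 0" F L x] by simp

lemma avgs_upd: "i \<notin> set L \<Longrightarrow> avgs L (\<lambda>y. F (y(i := a))) x = avgs L F (x(i := a))"
proof (induction L arbitrary: x)
  case (Cons j L)
  then have "avgs L (\<lambda>y. F (y(i := a))) = (\<lambda>x. avgs L F (x(i := a)))"
    by (intro ext) (rule Cons.IH, simp)
  then have "avgs (j # L) (\<lambda>y. F (y(i := a))) x = (\<Sum>b<m. avgs L F (x(j := b, i := a))) / real m"
    by (simp add: av_def)
  also have "\<dots> = avgs (j # L) F (x(i := a))"
    using Cons.prems fun_upd_twist[of i j x a] by (simp add: av_def)
  finally show ?case .
qed simp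

lemma avgs_cong_off: "(\<And>i. i \<notin> set L \<Longrightarrow> x i = y i) \<Longrightarrow> avgs L F x = avgs L F y"
proof (induction L arbitrary: x y)
  case Nil
  then have "x = y" by auto
  then show ?case by simp
next
  case (Cons i L)
  have "avgs L F (x(i := a)) = avgs L F (y(i := a))" for a
    by (rule Cons.IH) (use Cons.prems in auto)
  then show ?case by (simp add: av_def)
qed

lemma avgs_upd_in: "i \<in> set L \<Longrightarrow> avgs L F (x(i := a)) = avgs L F x"
  by (rule avgs_cong_off) auto

lemma abs_avgs_le: "\<bar>avgs L F x\<bar> \<le> avgs L (\<lambda>y. \<bar>F y\<bar>) x"
proof -
  have "avgs L F x \<le> avgs L (\<lambda>y. \<bar>F y\<bar>) x" by (rule avgs_mono) auto
  moreover have "avgs L (\<lambda>y. - 1 * F y) x \<le> avgs L (\<lambda>y. \<bar>F y\<bar>) x" by (rule avgs_mono) auto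
  ultimately show ?thesis by (simp add: avgs_cmult[of _ "- 1", simplified])
qed

lemma avgs_Cauchy_Schwarz:
  "avgs L (\<lambda>y. F y * G y) x \<le> sqrt (avgs L (\<lambda>y. (F y)\<^sup>2) x) * sqrt (avgs L (\<lambda>y. (G y)\<^sup>2) x)"
proof -
  define p q r where "p = avgs L (\<lambda>y. (F y)\<^sup>2) x" "q = avgs L (\<lambda>y. (G y)\<^sup>2) x" "r = avgs L (\<lambda>y. F y * G y) x"
  have nn: "0 \<le> p" "0 \<le> q" by (simp_all add: p_q_r_def avgs_nonneg)
  have quad: "0 \<le> s\<^sup>2 * p + t\<^sup>2 * q + (- 2 * s * t) * r" for s t
  proof -
    have "0 \<le> avgs L (\<lambda>y. (s * F y - t * G y)\<^sup>2) x" by (rule avgs_nonneg) simp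
    also have "(\<lambda>y. (s * F y - t * G y)\<^sup>2)
        = (\<lambda>y. s\<^sup>2 * (F y)\<^sup>2 + t\<^sup>2 * (G y)\<^sup>2 + (- 2 * s * t) * (F y * G y))"
      by (intro ext) (simp add: power2_eq_square algebra_simps)
    finally show ?thesis by (simp only: avgs_add avgs_cmult p_q_r_def)
  qed
  have "r\<^sup>2 \<le> p * q"
  proof (cases "q = 0")
    case True
    show ?thesis
    proof (cases "r = 0")
      case False
      \<comment> \<open>For q = 0 the form is affine in t, so a nonzero r would make it negative
        somewhere; this t gives the value -1.\<close>
      have "0 \<le> p + (- 2 * ((p + 1) / (2 * r))) * r" using quad[of 1 "(p + 1) / (2 * r)"] True by simp
      also have "\<dots> = - 1" using False by (simp add: field_simps)
      finally show ?thesis by simp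
    qed (use nn in simp)
  next
    case False
    then have q: "q > 0" using nn by simp
    have "0 \<le> q\<^sup>2 * p + r\<^sup>2 * q + (- 2 * q * r) * r" by (rule quad)
    also have "\<dots> = q * (p * q - r\<^sup>2)" by (simp add: power2_eq_square algebra_simps)
    finally show ?thesis using q by (simp add: zero_le_mult_iff)
  qed
  then have "\<bar>r\<bar> \<le> sqrt (p * q)" by (intro real_le_rsqrt) simp
  then show ?thesis using nn by (simp add: p_q_r_def real_sqrt_mult)
qed

lemma avgs_Minkowski:
  assumes "finite S"
  shows "avgs L (\<lambda>y. (\<Sum>a\<in>S. h a y)\<^sup>2) x \<le> (\<Sum>a\<in>S. sqrt (avgs L (\<lambda>y. (h a y)\<^sup>2) x))\<^sup>2"
proof -
  have "avgs L (\<lambda>y. (\<Sum>a\<in>S. h a y)\<^sup>2) x = (\<Sum>a\<in>S. \<Sum>b\<in>S. avgs L (\<lambda>y. h a y * h b y) x)"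
    using assms by (simp add: power2_eq_square sum_product avgs_sum)
  also have "\<dots> \<le> (\<Sum>a\<in>S. \<Sum>b\<in>S. sqrt (avgs L (\<lambda>y. (h a y)\<^sup>2) x) * sqrt (avgs L (\<lambda>y. (h b y)\<^sup>2) x))"
    by (intro sum_mono avgs_Cauchy_Schwarz)
  also have "\<dots> = (\<Sum>a\<in>S. sqrt (avgs L (\<lambda>y. (h a y)\<^sup>2) x))\<^sup>2"
    by (simp add: power2_eq_square sum_product)
  finally show ?thesis .
qed

lemma var_upd [simp]: "var i F (x(i := a)) = var i F x"
  by (simp add: var_def)

lemma av_var [simp]: "av i (var i F) = var i F"
proof
  show "av i (var i F) x = var i F x" for x using m_pos by (simp add: av_def[of i "var i F"])
qed

(* Tensorization: the one-coordinate inequality is applied to the square root of avgs L (h^2), whose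
  variance is controlled by Minkowski's inequality. *)
theorem log_Sobolev:
  assumes "distinct L"
  shows "avgs L (\<lambda>y. (h y)\<^sup>2 * ln ((h y)\<^sup>2)) x - avgs L (\<lambda>y. (h y)\<^sup>2) x * ln (avgs L (\<lambda>y. (h y)\<^sup>2) x)
    \<le> 2 * (real m + 1) * (\<Sum>i\<in>set L. avgs L (var i h) x)"
  using assms
proof (induction L arbitrary: x)
  case (Cons i L)
  define u where "u = avgs L (\<lambda>y. (h y)\<^sup>2)"
  define H where "H = (\<lambda>y. sqrt (u y))"
  define \<rho> where "\<rho> = 2 * (real m + 1)"
  have i: "i \<notin> set L" using Cons.prems by simp
  have u_nn: "0 \<le> u y" for y unfolding u_def by (intro avgs_nonneg) simp
  then have H2: "(\<lambda>y. (H y)\<^sup>2) = u" by (auto simp: H_def)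
  have IH: "avgs L (\<lambda>y. (h y)\<^sup>2 * ln ((h y)\<^sup>2)) y - u y * ln (u y)
      \<le> \<rho> * (\<Sum>j\<in>set L. avgs L (var j h) y)" for y
    unfolding u_def \<rho>_def using Cons by simp
  \<comment> \<open>Chain rule: the entropy along \<open>i # L\<close> is the
    \<open>i\<close>-average of the entropy along \<open>L\<close> plus the entropy of u along
    \<open>i\<close>. Here the induction hypothesis is averaged; the second summand is left to the
    one-coordinate inequality.\<close>
  have "av i (\<lambda>y. avgs L (\<lambda>y. (h y)\<^sup>2 * ln ((h y)\<^sup>2)) y - u y * ln (u y)) x
      \<le> av i (\<lambda>y. \<rho> * (\<Sum>j\<in>set L. avgs L (var j h) y)) x" by (rule av_mono) (rule IH)
  then have 1: "av i (avgs L (\<lambda>y. (h y)\<^sup>2 * ln ((h y)\<^sup>2))) x - av i (\<lambda>y. u y * ln (u y)) x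
      \<le> \<rho> * (\<Sum>j\<in>set L. av i (avgs L (var j h)) x)"
    by (simp add: av_diff av_cmult av_sum)
  have 2: "av i (\<lambda>y. u y * ln (u y)) x - av i u x * ln (av i u x) \<le> \<rho> * var i H x"
    using entropy_le_variance[OF m_pos, of "\<lambda>a. H (x(i := a))"] u_nn
    by (simp add: var_def av_def H_def \<rho>_def)
  \<comment> \<open>Since \<open>i\<close> is not in \<open>L\<close>, the L2 norms of the slices
    \<open>h (y(i := a))\<close> are the values of H at \<open>x(i := a)\<close>, so the triangle
    inequality produces exactly \<open>av i H\<close>.\<close>
  have "avgs L (\<lambda>y. (av i h y)\<^sup>2) x
      = avgs L (\<lambda>y. (\<Sum>a<m. h (y(i := a)) / real m)\<^sup>2) x"
    by (simp add: av_def sum_divide_distrib)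
  also have "\<dots> \<le> (\<Sum>a<m. sqrt (avgs L (\<lambda>y. (h (y(i := a)) / real m)\<^sup>2) x))\<^sup>2"
    by (rule avgs_Minkowski) simp
  also have "(\<lambda>a. avgs L (\<lambda>y. (h (y(i := a)) / real m)\<^sup>2) x) = (\<lambda>a. u (x(i := a)) / (real m)\<^sup>2)"
    using avgs_upd[OF i, of "\<lambda>y. (h y)\<^sup>2" _ x] avgs_cmult[of L "1 / (real m)\<^sup>2"]
    by (simp add: u_def power_divide)
  also have "(\<Sum>a<m. sqrt (u (x(i := a)) / (real m)\<^sup>2)) = av i H x"
    by (simp add: av_def H_def real_sqrt_divide sum_divide_distrib)
  finally have 3: "avgs L (\<lambda>y. (av i h y)\<^sup>2) x \<le> (av i H x)\<^sup>2" .
  have "av i (avgs L (var i h)) x = avgs L (var i h) x" by (simp add: avgs_av[symmetric])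
  also have "\<dots> = avgs L (av i (\<lambda>y. (h y)\<^sup>2)) x - avgs L (\<lambda>y. (av i h y)\<^sup>2) x"
    by (simp add: var_def[abs_def] avgs_diff)
  also have "avgs L (av i (\<lambda>y. (h y)\<^sup>2)) x = av i u x" by (simp add: avgs_av u_def)
  finally have "var i H x \<le> av i (avgs L (var i h)) x" using 3 unfolding var_def[of i H] H2 by linarith
  then have "\<rho> * var i H x \<le> \<rho> * av i (avgs L (var i h)) x" by (intro mult_left_mono) (auto simp: \<rho>_def)
  then show ?case using 1 2 i unfolding \<rho>_def[symmetric] by (simp add: u_def[symmetric] distrib_left)
qed simp

lemma square_av_le: "(av i F x)\<^sup>2 \<le> av i (\<lambda>y. (F y)\<^sup>2) x"
proof -
  have "(av i F x)\<^sup>2 * (real m)\<^sup>2 \<le> av i (\<lambda>y. (F y)\<^sup>2) x * (real m)\<^sup>2"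
    using Cauchy_Schwarz_ineq_sum[of "\<lambda>a. F (x(i:=a))" "\<lambda>a. 1" "{..<m}"] m_pos
    by (simp add: av_def power_divide power2_eq_square[of "real m"])
  then show ?thesis using m_pos by simp
qed

text \<open>Pointwise, \<Lambda> h^2 is at most h^2 ln(h^2 / A) plus a multiple of |h|: the first
  term suffices where h^2 / A is at least exp \<Lambda>, the second takes over elsewhere. Averaging
  this and applying \<open>log_Sobolev\<close> leaves a term in sqrt A, half of \<Lambda> A being
  used to absorb it. \<Lambda> is chosen so that the energy ends up with the factor s.\<close>

lemma super_Poincare:
  assumes "distinct L" "s > 0"
  defines "\<Lambda> \<equiv> 4 * (real m + 1) / s"
  shows "avgs L (\<lambda>y. (h y)\<^sup>2) x
    \<le> s * (\<Sum>i\<in>set L. avgs L (var i h) x) + 4 * exp \<Lambda> / \<Lambda>\<^sup>2 * (avgs L (\<lambda>y. \<bar>h y\<bar>) x)\<^sup>2"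
proof -
  define A where "A = avgs L (\<lambda>y. (h y)\<^sup>2) x"
  define b where "b = avgs L (\<lambda>y. \<bar>h y\<bar>) x"
  define D where "D = (\<Sum>i\<in>set L. avgs L (var i h) x)"
  have \<Lambda>: "\<Lambda> > 0" using assms by (simp add: \<Lambda>_def)
  have A_nn: "0 \<le> A" unfolding A_def by (intro avgs_nonneg) simp
  have LS: "avgs L (\<lambda>y. (h y)\<^sup>2 * ln ((h y)\<^sup>2)) x - A * ln A \<le> 2 * (real m + 1) * D"
    unfolding A_def D_def by (rule log_Sobolev) fact
  have "\<Lambda> * A \<le> 2 * (real m + 1) * D + 2 * exp (\<Lambda> / 2) * sqrt A * b"
  proof (cases "A = 0")
    case True
    have D: "D \<ge> 0" unfolding D_def
    proof (intro sum_nonneg avgs_nonneg)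
      show "0 \<le> var i h y" for i y using square_av_le[of i h y] by (simp add: var_def)
    qed
    then show ?thesis using True by simp
  next
    case False
    then have A: "A > 0" using A_nn by simp
    have pw: "\<Lambda> * (h y)\<^sup>2 \<le> (h y)\<^sup>2 * ln ((h y)\<^sup>2) - ln A * (h y)\<^sup>2 + (2 * exp (\<Lambda> / 2) * sqrt A) * \<bar>h y\<bar>" for y
    proof (cases "h y = 0")
      case False
      \<comment> \<open>Chosen so that 2 ln w = ln(h^2 / A) - \<Lambda>; the pointwise claim then
        reads - ln w <= 1 / w, multiplied by 2 h^2.\<close>
      define w where "w = \<bar>h y\<bar> * exp (- \<Lambda> / 2) / sqrt A"
      have w: "w > 0" using False A by (simp add: w_def)
      have "ln (1 / w) \<le> 1 / w - 1" using w by (intro ln_le_minus_one) auto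
      then have "- ln w \<le> 1 / w" using w by (simp add: ln_div)
      then have "2 * (h y)\<^sup>2 * (- ln w) \<le> 2 * (h y)\<^sup>2 * (1 / w)" by (intro mult_left_mono) auto
      also have "2 * (h y)\<^sup>2 * (1 / w) = (2 * exp (\<Lambda> / 2) * sqrt A) * \<bar>h y\<bar>"
      proof -
        have "(h y)\<^sup>2 = \<bar>h y\<bar> * \<bar>h y\<bar>" by (simp add: power2_eq_square)
        then show ?thesis using False by (simp add: w_def exp_minus field_simps)
      qed
      also have "- ln w = \<Lambda> / 2 + ln A / 2 - ln ((h y)\<^sup>2) / 2"
      proof -
        have "ln w = ln \<bar>h y\<bar> + (- \<Lambda> / 2) - ln (sqrt A)"
          using False A by (simp add: w_def ln_div ln_mult)
        moreover have "ln (sqrt A) = ln A / 2" using A by (simp add: ln_sqrt)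
        moreover have "ln ((h y)\<^sup>2) = 2 * ln \<bar>h y\<bar>"
          using False ln_realpow[of "\<bar>h y\<bar>" 2] by simp
        ultimately show ?thesis by simp
      qed
      finally show ?thesis by (simp add: algebra_simps)
    qed simp
    have "avgs L (\<lambda>y. \<Lambda> * (h y)\<^sup>2) x
      \<le> avgs L (\<lambda>y. (h y)\<^sup>2 * ln ((h y)\<^sup>2) - ln A * (h y)\<^sup>2 + (2 * exp (\<Lambda> / 2) * sqrt A) * \<bar>h y\<bar>) x"
      by (rule avgs_mono) (rule pw)
    then have "\<Lambda> * A \<le> avgs L (\<lambda>y. (h y)\<^sup>2 * ln ((h y)\<^sup>2)) x - ln A * A + 2 * exp (\<Lambda> / 2) * sqrt A * b"
      unfolding avgs_add avgs_diff avgs_cmult A_def[symmetric] b_def[symmetric] .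
    then show ?thesis using LS by (simp only: mult.commute[of "ln A"])
  qed
  \<comment> \<open>Arithmetic-geometric mean, weighted so that the term in A is half of the
    left-hand side.\<close>
  also have "2 * exp (\<Lambda> / 2) * sqrt A * b \<le> \<Lambda> / 2 * A + 2 * exp \<Lambda> / \<Lambda> * b\<^sup>2"
  proof -
    have "0 \<le> (\<Lambda> * sqrt A - 2 * exp (\<Lambda> / 2) * b)\<^sup>2" by simp
    also have "\<dots> = \<Lambda>\<^sup>2 * A + 4 * (exp (\<Lambda> / 2))\<^sup>2 * b\<^sup>2 - 2 * \<Lambda> * (2 * exp (\<Lambda> / 2) * sqrt A * b)"
      using A_nn by (simp add: power2_diff power_mult_distrib algebra_simps)
    also have "(exp (\<Lambda> / 2))\<^sup>2 = exp \<Lambda>" by (simp add: exp_double[symmetric])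
    finally have "2 * \<Lambda> * (2 * exp (\<Lambda> / 2) * sqrt A * b) \<le> 2 * \<Lambda> * (\<Lambda> / 2 * A + 2 * exp \<Lambda> / \<Lambda> * b\<^sup>2)"
      using \<Lambda> by (simp add: algebra_simps power2_eq_square)
    then show ?thesis using \<Lambda> by (subst (asm) mult_le_cancel_left_pos) auto
  qed
  finally have "\<Lambda> / 2 * A \<le> 2 * (real m + 1) * D + 2 * exp \<Lambda> / \<Lambda> * b\<^sup>2" by simp
  then have "2 / \<Lambda> * (\<Lambda> / 2 * A) \<le> 2 / \<Lambda> * (2 * (real m + 1) * D + 2 * exp \<Lambda> / \<Lambda> * b\<^sup>2)"
    using \<Lambda> by (intro mult_left_mono) auto
  moreover have "2 / \<Lambda> * (2 * (real m + 1) * D) = s * D"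
    using assms by (simp add: \<Lambda>_def field_simps)
  ultimately have "A \<le> s * D + 4 * exp \<Lambda> / \<Lambda>\<^sup>2 * b\<^sup>2"
    using \<Lambda> by (simp add: distrib_left power2_eq_square)
  then show ?thesis by (simp add: A_def b_def D_def)
qed

end

section \<open>Juntas on the grid\<close>

text \<open>The summand y makes the inverse 1-Lipschitz; the summand y |y| makes squared differences
  of the inverse at most twice the differences of its arguments.\<close>

definition quad :: "real \<Rightarrow> real" where "quad y = y + y * \<bar>y\<bar>"

text \<open>The nonnegative root of w + w^2 = |t|, with the sign of t.\<close>

definition quad_inv :: "real \<Rightarrow> real" where
  "quad_inv t = sgn t * (sqrt (\<bar>t\<bar> + 1 / 4) - 1 / 2)"

lemma quad_quad_inv [simp]: "quad (quad_inv t) = t"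
proof -
  define w where "w = sqrt (\<bar>t\<bar> + 1 / 4) - 1 / 2"
  have "sqrt (1 / 4) = (1 / 2 :: real)" by (simp add: real_sqrt_divide)
  then have w: "0 \<le> w" using real_sqrt_le_mono[of "1 / 4" "\<bar>t\<bar> + 1 / 4"] unfolding w_def by linarith
  have "(w + 1 / 2)\<^sup>2 = \<bar>t\<bar> + 1 / 4" by (simp add: w_def)
  then have "w + w * w = \<bar>t\<bar>" by (simp add: power2_eq_square algebra_simps)
  moreover have "quad (quad_inv t) = sgn t * (w + w * w)"
    using w by (cases "t = 0") (auto simp: quad_def quad_inv_def w_def[symmetric] abs_mult sgn_real_def algebra_simps)
  ultimately show ?thesis by (simp add: sgn_mult_abs)
qed

lemma quad_diff_ge:
  "\<bar>y - z\<bar> \<le> \<bar>quad y - quad z\<bar>" "(y - z)\<^sup>2 \<le> 2 * \<bar>quad y - quad z\<bar>"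
proof -
  have *: "y - z \<le> quad y - quad z \<and> (y - z)\<^sup>2 \<le> 2 * (quad y - quad z)" if "z \<le> y" for y z
  proof -
    \<comment> \<open>For arguments of equal sign the difference is (y - z)(|y| + |z|). The factor 2
      is spent on opposite signs, where it becomes (y - z)^2 <= 2 y^2 + 2 z^2.\<close>
    have 1: "(y - z)\<^sup>2 \<le> 2 * (y * \<bar>y\<bar> - z * \<bar>z\<bar>)"
    proof (cases "0 \<le> z \<or> y \<le> 0")
      case True
      have "y * \<bar>y\<bar> - z * \<bar>z\<bar> = (y - z) * (\<bar>y\<bar> + \<bar>z\<bar>)"
        using True that by (auto simp: algebra_simps)
      also have "\<dots> \<ge> (y - z) * (y - z)" using that by (intro mult_left_mono) auto
      finally have 1: "(y - z)\<^sup>2 \<le> y * \<bar>y\<bar> - z * \<bar>z\<bar>" by (simp add: power2_eq_square)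
      then have "0 \<le> y * \<bar>y\<bar> - z * \<bar>z\<bar>" using order_trans zero_le_power2 by blast
      with 1 show ?thesis by simp
    next
      case False
      then have "2 * (y * \<bar>y\<bar> - z * \<bar>z\<bar>) = 2 * y\<^sup>2 + 2 * z\<^sup>2" by (simp add: power2_eq_square)
      then show ?thesis using zero_le_power2[of "y + z"] by (simp add: power2_eq_square algebra_simps)
    qed
    moreover define X where "X = y * \<bar>y\<bar> - z * \<bar>z\<bar>"
    moreover define D where "D = (y - z)\<^sup>2"
    ultimately have "D \<le> 2 * X" "0 \<le> D" by auto
    moreover have "quad y - quad z = (y - z) + X" by (simp add: quad_def X_def)
    ultimately have X: "D \<le> 2 * X" "0 \<le> X" "quad y - quad z = (y - z) + X" by auto
    have "y - z \<le> quad y - quad z" using X by simp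
    moreover have "D \<le> 2 * (quad y - quad z)" using X that by simp
    ultimately show ?thesis by (simp add: D_def)
  qed
  show "\<bar>y - z\<bar> \<le> \<bar>quad y - quad z\<bar>" "(y - z)\<^sup>2 \<le> 2 * \<bar>quad y - quad z\<bar>"
    using *[of y z] *[of z y] by (cases "z \<le> y"; simp add: power2_commute[of y z])+
qed

text \<open>The way back from L2 to L1: a small L2 distance is paired with a factor that is only
  bounded in L2.\<close>

lemma quad_diff_le: "\<bar>quad y - quad z\<bar> \<le> \<bar>y - z\<bar> * (1 + \<bar>y\<bar> + \<bar>z\<bar>)"
proof -
  have "quad y - quad z = (y - z) + ((y - z) * \<bar>y\<bar> + z * (\<bar>y\<bar> - \<bar>z\<bar>))"
    by (simp add: quad_def algebra_simps)
  also have "\<bar>\<dots>\<bar> \<le> \<bar>y - z\<bar> + (\<bar>y - z\<bar> * \<bar>y\<bar> + \<bar>z\<bar> * \<bar>\<bar>y\<bar> - \<bar>z\<bar>\<bar>)"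
    by (rule order_trans[OF abs_triangle_ineq], rule add_left_mono, rule order_trans[OF abs_triangle_ineq])
      (simp add: abs_mult)
  also have "\<bar>z\<bar> * \<bar>\<bar>y\<bar> - \<bar>z\<bar>\<bar> \<le> \<bar>z\<bar> * \<bar>y - z\<bar>" by (intro mult_left_mono abs_triangle_ineq3) auto
  finally show ?thesis by (simp add: algebra_simps)
qed

text \<open>With q = \<open>quad_inv t\<close> one has |t| = |q| (1 + |q|). Thus an L1 bound on F -
  E F becomes an L2 bound on G.\<close>

lemma quad_inv_square_le: "(quad_inv t)\<^sup>2 \<le> \<bar>t\<bar>"
proof -
  have "quad q = q * (1 + \<bar>q\<bar>)" for q by (simp add: quad_def algebra_simps)
  then have "\<bar>quad q\<bar> = \<bar>q\<bar> * (1 + \<bar>q\<bar>)" for q by (simp add: abs_mult)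
  from this[of "quad_inv t"] have "\<bar>t\<bar> = \<bar>quad_inv t\<bar> * (1 + \<bar>quad_inv t\<bar>)" by simp
  then show ?thesis by (simp add: algebra_simps power2_eq_square)
qed

section \<open>Influences, orthogonality of averages, and juntas on the grid\<close>

context grid begin

text \<open>Differences of two values are averaged, not distances to \<open>av i F\<close>, because
  a bound on differences passes through \<open>quad_inv\<close> pointwise.\<close>

definition infl :: "'i list \<Rightarrow> 'i \<Rightarrow> (('i \<Rightarrow> nat) \<Rightarrow> real) \<Rightarrow> ('i \<Rightarrow> nat) \<Rightarrow> real" where
  "infl L i F x = avgs L (\<lambda>y. av i (\<lambda>z. \<bar>F y - F z\<bar>) y) x"

lemma diff_av: "F y - av i F y = av i (\<lambda>z. F y - F z) y"
  by (simp add: av_diff)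

lemma avgs_mult_av:
  assumes "i \<in> set L"
  shows "avgs L (\<lambda>y. F y * av i G y) x = avgs L (\<lambda>y. av i F y * av i G y) x"
proof -
  have "avgs L (\<lambda>y. F y * av i G y) x = avgs L (av i (\<lambda>y. av i G y * F y)) x"
    by (simp only: avgs_absorb[OF assms] mult.commute)
  also have "av i (\<lambda>y. av i G y * F y) = (\<lambda>y. av i F y * av i G y)"
    by (intro ext) (subst av_mult, auto)
  finally show ?thesis .
qed

lemma avgs_adjoint:
  assumes "set P \<subseteq> set L"
  shows "avgs L (\<lambda>y. F y * avgs P G y) x = avgs L (\<lambda>y. avgs P F y * G y) x"
  using assms
proof (induction P arbitrary: F G)
  case (Cons i P)
  have i: "i \<in> set L" using Cons.prems by simp
  have "avgs L (\<lambda>y. F y * avgs (i # P) G y) x = avgs L (\<lambda>y. avgs P G y * av i F y) x"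
    using avgs_mult_av[OF i, of F "avgs P G" x] avgs_mult_av[OF i, of "avgs P G" F x]
    by (simp add: mult.commute)
  also have "\<dots> = avgs L (\<lambda>y. av i F y * avgs P G y) x" by (simp only: mult.commute)
  also have "\<dots> = avgs L (\<lambda>y. avgs P (av i F) y * G y) x" using Cons by simp
  finally show ?case by (simp add: avgs_av)
qed simp

text \<open>Pythagoras: by \<open>avgs_adjoint\<close> and absorption, \<open>avgs P\<close> is a
  self-adjoint idempotent, that is, an orthogonal projection.\<close>

lemma avgs_square_diff:
  assumes "set P \<subseteq> set L"
  shows "avgs L (\<lambda>y. (F y - avgs P F y)\<^sup>2) x = avgs L (\<lambda>y. (F y)\<^sup>2) x - avgs L (\<lambda>y. (avgs P F y)\<^sup>2) x"
proof -
  have "avgs L (\<lambda>y. F y * avgs P F y) x = avgs L (\<lambda>y. F y * avgs P (avgs P F) y) x"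
    by (simp add: avgs_avgs_absorb)
  also have "\<dots> = avgs L (\<lambda>y. (avgs P F y)\<^sup>2) x"
    using avgs_adjoint[OF assms] by (simp add: power2_eq_square)
  finally have "avgs L (\<lambda>y. F y * avgs P F y) x = avgs L (\<lambda>y. (avgs P F y)\<^sup>2) x" .
  moreover have "(\<lambda>y. (F y - avgs P F y)\<^sup>2)
      = (\<lambda>y. (F y)\<^sup>2 + (avgs P F y)\<^sup>2 - 2 * (F y * avgs P F y))"
    by (intro ext) (simp add: power2_eq_square algebra_simps)
  ultimately show ?thesis by (simp add: avgs_add avgs_diff avgs_cmult)
qed

lemma avgs_square_diff_av:
  "i \<in> set L \<Longrightarrow> avgs L (\<lambda>y. (F y - av i F y)\<^sup>2) x = avgs L (\<lambda>y. (F y)\<^sup>2) x - avgs L (\<lambda>y. (av i F y)\<^sup>2) x"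
  using avgs_square_diff[of "[i]" L F x] by simp

lemma avgs_var:
  "i \<in> set L \<Longrightarrow> avgs L (var i F) x = avgs L (\<lambda>y. (F y - av i F y)\<^sup>2) x"
  by (simp add: avgs_square_diff_av var_def[abs_def] avgs_diff avgs_absorb)

lemma avgs_abs_avgs_le:
  assumes "set P \<subseteq> set L"
  shows "avgs L (\<lambda>y. \<bar>avgs P F y\<bar>) x \<le> avgs L (\<lambda>y. \<bar>F y\<bar>) x"
proof -
  have "avgs L (\<lambda>y. \<bar>avgs P F y\<bar>) x \<le> avgs L (avgs P (\<lambda>y. \<bar>F y\<bar>)) x"
    by (rule avgs_mono) (rule abs_avgs_le)
  then show ?thesis by (simp add: avgs_avgs_absorb[OF assms])
qed

lemma avgs_abs_diff_av_le: "avgs L (\<lambda>y. \<bar>F y - av i F y\<bar>) x \<le> infl L i F x"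
  unfolding infl_def diff_av by (intro avgs_mono abs_av_le)

text \<open>Telescoping: F - \<open>avgs (i # P) F\<close> is F - \<open>av i F\<close> plus the
  \<open>i\<close>-average of F - \<open>avgs P F\<close>, and averaging contracts L1. For P = L
  this is an L1 Poincare inequality, which bounds F - E F by the total influence.\<close>

lemma avgs_abs_diff_avgs_le:
  assumes "set P \<subseteq> set L" "distinct P"
  shows "avgs L (\<lambda>y. \<bar>F y - avgs P F y\<bar>) x \<le> (\<Sum>i\<in>set P. infl L i F x)"
  using assms
proof (induction P)
  case (Cons i P)
  have "avgs L (\<lambda>y. \<bar>F y - avgs (i # P) F y\<bar>) x
      \<le> avgs L (\<lambda>y. \<bar>F y - av i F y\<bar> + \<bar>avgs [i] (\<lambda>y. F y - avgs P F y) y\<bar>) x"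
    by (rule avgs_mono) (simp add: av_diff)
  also have "\<dots> \<le> infl L i F x + avgs L (\<lambda>y. \<bar>F y - avgs P F y\<bar>) x"
    unfolding avgs_add using Cons.prems by (intro add_mono avgs_abs_diff_av_le avgs_abs_avgs_le) auto
  finally show ?case using Cons by simp
qed simp

(* Applied to each martingale difference d of G along P; the energies telescope since
  d = W - av i W is an orthogonal decomposition commuting with av j. *)
lemma martingale_energy:
  assumes SP: "\<And>h. avgs L (\<lambda>y. (h y)\<^sup>2) x
      \<le> s * (\<Sum>j\<in>set L. avgs L (var j h) x) + \<beta> * (avgs L (\<lambda>y. \<bar>h y\<bar>) x)\<^sup>2"
    and "\<beta> \<ge> 0" "set P \<subseteq> set L" "distinct P"
  shows "avgs L (\<lambda>y. (G y - avgs P G y)\<^sup>2) x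
    \<le> s * (\<Sum>j\<in>set L. avgs L (var j G) x - avgs L (var j (avgs P G)) x)
      + \<beta> * (\<Sum>i\<in>set P. (infl L i G x)\<^sup>2)"
  using assms(3,4)
proof (induction P)
  case (Cons i P)
  define W where "W = avgs P G"
  define d where "d = (\<lambda>y. W y - av i W y)"
  have i: "i \<in> set L" "i \<notin> set P" and P: "set P \<subseteq> set L" using Cons.prems by auto
  have "avgs L (\<lambda>y. (G y - avgs (i # P) G y)\<^sup>2) x
      = avgs L (\<lambda>y. (G y - W y)\<^sup>2) x + avgs L (\<lambda>y. (d y)\<^sup>2) x"
    unfolding avgs_square_diff[OF Cons.prems(1)] unfolding W_def avgs_square_diff[OF P] d_def
    using avgs_square_diff_av[OF i(1), of W] by (simp add: W_def)
  also have "avgs L (\<lambda>y. (d y)\<^sup>2) x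
      \<le> s * (\<Sum>j\<in>set L. avgs L (var j d) x) + \<beta> * (avgs L (\<lambda>y. \<bar>d y\<bar>) x)\<^sup>2" by (rule SP)
  also have "(\<Sum>j\<in>set L. avgs L (var j d) x)
      = (\<Sum>j\<in>set L. avgs L (var j W) x - avgs L (var j (av i W)) x)"
  proof (rule sum.cong)
    fix j assume j: "j \<in> set L"
    define D where "D = (\<lambda>y. W y - av j W y)"
    have avD: "av i D = (\<lambda>y. av i W y - av j (av i W) y)"
      by (simp add: D_def av_diff av_commute[of j i] fun_eq_iff)
    have "(\<lambda>y. d y - av j d y) = (\<lambda>y. D y - av i D y)"
      unfolding avD by (simp add: D_def d_def av_diff fun_eq_iff)
    then have "avgs L (var j d) x = avgs L (\<lambda>y. (D y - av i D y)\<^sup>2) x"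
      unfolding avgs_var[OF j] by (simp add: fun_eq_iff)
    also have "\<dots> = avgs L (\<lambda>y. (D y)\<^sup>2) x - avgs L (\<lambda>y. (av i D y)\<^sup>2) x"
      by (rule avgs_square_diff_av[OF i(1)])
    finally show "avgs L (var j d) x = avgs L (var j W) x - avgs L (var j (av i W)) x"
      unfolding avgs_var[OF j] avD by (simp add: D_def)
  qed simp
  also have "\<beta> * (avgs L (\<lambda>y. \<bar>d y\<bar>) x)\<^sup>2 \<le> \<beta> * (infl L i G x)\<^sup>2"
  proof (intro mult_left_mono power_mono \<open>\<beta> \<ge> 0\<close>)
    \<comment> \<open>As the averages commute, d is itself an average, so its L1 norm is bounded by
      an influence of the original G and nothing accumulates along P.\<close>
    have "d = avgs P (\<lambda>y. G y - av i G y)"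
      by (simp add: d_def W_def avgs_diff avgs_av fun_eq_iff)
    then have "avgs L (\<lambda>y. \<bar>d y\<bar>) x \<le> avgs L (\<lambda>y. \<bar>G y - av i G y\<bar>) x"
      using avgs_abs_avgs_le[OF P] by simp
    also have "\<dots> \<le> infl L i G x" by (rule avgs_abs_diff_av_le)
    finally show "avgs L (\<lambda>y. \<bar>d y\<bar>) x \<le> infl L i G x" .
  qed (simp add: avgs_nonneg)
  finally have "avgs L (\<lambda>y. (G y - avgs (i # P) G y)\<^sup>2) x
      \<le> avgs L (\<lambda>y. (G y - W y)\<^sup>2) x
      + (s * (\<Sum>j\<in>set L. avgs L (var j W) x - avgs L (var j (av i W)) x) + \<beta> * (infl L i G x)\<^sup>2)"
    by simp
  also have "\<dots> \<le> s * (\<Sum>j\<in>set L. avgs L (var j G) x - avgs L (var j W) x)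
      + \<beta> * (\<Sum>i\<in>set P. (infl L i G x)\<^sup>2)
      + (s * (\<Sum>j\<in>set L. avgs L (var j W) x - avgs L (var j (av i W)) x) + \<beta> * (infl L i G x)\<^sup>2)"
    unfolding W_def using Cons P by (intro add_right_mono Cons.IH) auto
  also have "\<dots> = s * (\<Sum>j\<in>set L. avgs L (var j G) x - avgs L (var j (av i W)) x)
      + \<beta> * (\<Sum>i\<in>set (i # P). (infl L i G x)\<^sup>2)"
    using i by (simp add: sum_subtractf algebra_simps)
  finally show ?case by (simp add: W_def)
qed simp

theorem junta_approximation:
  fixes \<epsilon> K :: real
  assumes "\<epsilon> > 0" "K \<ge> 0"
  shows "\<exists>C>0. \<forall>(L :: 'i list) F x. distinct L \<longrightarrow> (\<Sum>i\<in>set L. infl L i F x) \<le> K \<longrightarrow>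
      (\<exists>J\<subseteq>set L. real (card J) \<le> C \<and>
        (\<exists>g. (\<forall>y z. (\<forall>k. k \<notin> set L - J \<longrightarrow> y k = z k) \<longrightarrow> g y = g z) \<and>
          avgs L (\<lambda>y. \<bar>F y - g y\<bar>) x \<le> \<epsilon>))"
proof -
  \<comment> \<open>T is the weight in the final arithmetic-geometric mean: it makes the bounded
    part contribute \<epsilon> / 2. Then s and \<delta> make the energy part and the influence part
    contribute at most \<epsilon> / 4 each; \<beta> is the constant of \<open>super_Poincare\<close>
    for this s. Adding 1 to K and to \<beta> keeps the denominators positive.\<close>
  define T where "T = 3 * (1 + 2 * K) / (2 * \<epsilon>)"
  define s where "s = \<epsilon> / (8 * T * (K + 1))"
  define \<beta> where "\<beta> = 4 * exp (4 * (real m + 1) / s) / (4 * (real m + 1) / s)\<^sup>2"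
  define \<delta> where "\<delta> = \<epsilon> / (4 * T * (\<beta> + 1) * (K + 1))"
  have T: "T > 0" using assms by (simp add: T_def)
  have s: "s > 0" using assms T by (simp add: s_def)
  have \<beta>: "\<beta> \<ge> 0" by (simp add: \<beta>_def)
  have \<delta>: "\<delta> > 0" using assms T \<beta> by (simp add: \<delta>_def)
  have sT: "T * (s * (2 * K)) \<le> \<epsilon> / 4"
  proof -
    have "T * (\<epsilon> / (8 * T * k) * (2 * K)) = \<epsilon> / 4 * (K / k)" if "k > 0" for k
      using T that by (simp add: field_simps)
    from this[of "K + 1"] have "T * (s * (2 * K)) = \<epsilon> / 4 * (K / (K + 1))"
      using assms by (simp add: s_def)
    also have "\<dots> \<le> \<epsilon> / 4 * 1" using assms by (intro mult_left_mono) auto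
    finally show ?thesis by simp
  qed
  have \<delta>T: "T * (\<beta> * (\<delta> * K)) \<le> \<epsilon> / 4"
  proof -
    have "T * (\<beta> * (\<epsilon> / (4 * T * b * k) * K)) = \<epsilon> / 4 * ((\<beta> / b) * (K / k))" if "k > 0" "b > 0" for k b
      using T that by (simp add: field_simps)
    from this[of "K + 1" "\<beta> + 1"] have "T * (\<beta> * (\<delta> * K)) = \<epsilon> / 4 * ((\<beta> / (\<beta> + 1)) * (K / (K + 1)))"
      using assms \<beta> by (simp add: \<delta>_def)
    also have "\<dots> \<le> \<epsilon> / 4 * (1 * 1)" using assms \<beta> by (intro mult_left_mono mult_mono) auto
    finally show ?thesis by simp
  qed
  show ?thesis
  \<comment> \<open>At most K / \<delta> coordinates can have influence above \<delta>; the 1 keeps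
    the bound positive when K = 0.\<close>
  proof (intro exI[of _ "K / \<delta> + 1"] conjI allI impI)
    show "K / \<delta> + 1 > 0" using assms \<delta> by (simp add: add_nonneg_pos)
    fix L :: "'i list" and F x
    assume L: "distinct L" and K: "(\<Sum>i\<in>set L. infl L i F x) \<le> K"
    define E where "E = (\<lambda>H. avgs L H x)"
    define I where "I = (\<lambda>i. infl L i F x)"
    define J where "J = {i \<in> set L. I i > \<delta>}"
    define P where "P = filter (\<lambda>i. i \<notin> J) L"
    define G where "G = (\<lambda>y. quad_inv (F y - avgs L F y))"
    define W where "W = avgs P G"
    \<comment> \<open>\<open>avgs L F y\<close> does not involve the coordinates in
      \<open>L\<close>, so it plays the role of the constant E F.\<close>
    define g where "g = (\<lambda>y. quad (W y) + avgs L F y)"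
    have P: "set P = set L - J" "distinct P" "set P \<subseteq> set L" using L by (auto simp: P_def)
    have I_nn: "0 \<le> I i" for i unfolding I_def infl_def
      by (intro avgs_nonneg) (simp add: av_def sum_nonneg)
    have "J \<subseteq> set L" by (auto simp: J_def)
    moreover have "real (card J) \<le> K / \<delta> + 1"
    proof -
      have "real (card J) * \<delta> = (\<Sum>i\<in>J. \<delta>)" by simp
      also have "\<dots> \<le> (\<Sum>i\<in>J. I i)" by (intro sum_mono) (auto simp: J_def)
      also have "\<dots> \<le> (\<Sum>i\<in>set L. I i)" by (intro sum_mono2) (auto simp: J_def I_nn)
      also have "\<dots> \<le> K" using K by (simp add: I_def)
      finally have "real (card J) \<le> K / \<delta>" using \<delta> by (simp add: field_simps)
      then show ?thesis by simp
    qed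
    moreover have "\<forall>y z. (\<forall>k. k \<notin> set L - J \<longrightarrow> y k = z k) \<longrightarrow> g y = g z"
    proof (intro allI impI)
      fix y z :: "'i \<Rightarrow> nat" assume yz: "\<forall>k. k \<notin> set L - J \<longrightarrow> y k = z k"
      have "W y = W z" unfolding W_def by (rule avgs_cong_off) (use yz P in auto)
      moreover have "avgs L F y = avgs L F z" by (rule avgs_cong_off) (use yz in auto)
      ultimately show "g y = g z" by (simp add: g_def)
    qed
    moreover have "avgs L (\<lambda>y. \<bar>F y - g y\<bar>) x \<le> \<epsilon>"
    proof -
      have qG: "quad (G y) = F y - avgs L F y" for y by (simp add: G_def)
      have EG: "E (\<lambda>y. (G y)\<^sup>2) \<le> K"
      proof -
        have "E (\<lambda>y. (G y)\<^sup>2) \<le> E (\<lambda>y. \<bar>F y - avgs L F y\<bar>)"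
          unfolding E_def G_def by (intro avgs_mono quad_inv_square_le)
        also have "\<dots> \<le> (\<Sum>i\<in>set L. infl L i F x)" unfolding E_def using L by (intro avgs_abs_diff_avgs_le) auto
        finally show ?thesis using K by linarith
      qed
      have EW: "E (\<lambda>y. (W y)\<^sup>2) \<le> K"
      proof -
        have "0 \<le> E (\<lambda>y. (G y - W y)\<^sup>2)" unfolding E_def by (intro avgs_nonneg) simp
        then show ?thesis using avgs_square_diff[OF P(3), of G x] EG by (simp add: E_def W_def)
      qed
      \<comment> \<open>The subtracted mean cancels in a difference along a coordinate of
        \<open>L\<close>, so both bounds of \<open>quad_diff_ge\<close> carry over from G to
        F.\<close>
      have diff: "quad (G y) - quad (G (y(i := a))) = F y - F (y(i := a))" if "i \<in> set L" for i y a
        unfolding qG using avgs_upd_in[OF that, of F y a] by simp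
      have inflG: "infl L i G x \<le> I i" if "i \<in> set L" for i
        unfolding infl_def I_def using diff[OF that] quad_diff_ge(1)
        by (intro avgs_mono av_mono) metis
      have varG: "avgs L (var i G) x \<le> 2 * I i" if "i \<in> set L" for i
      proof -
        have "avgs L (var i G) x \<le> avgs L (\<lambda>y. av i (\<lambda>z. (G y - G z)\<^sup>2) y) x"
          unfolding avgs_var[OF that] diff_av by (intro avgs_mono square_av_le)
        also have "\<dots> \<le> avgs L (\<lambda>y. av i (\<lambda>z. 2 * \<bar>F y - F z\<bar>) y) x"
          using diff[OF that] quad_diff_ge(2) by (intro avgs_mono av_mono) metis
        finally show ?thesis by (simp add: av_cmult avgs_cmult I_def infl_def)
      qed
      have EGW: "E (\<lambda>y. (G y - W y)\<^sup>2) \<le> s * (2 * K) + \<beta> * (\<delta> * K)"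
      proof -
        have "E (\<lambda>y. (G y - W y)\<^sup>2)
            \<le> s * (\<Sum>j\<in>set L. avgs L (var j G) x - avgs L (var j W) x) + \<beta> * (\<Sum>i\<in>set P. (infl L i G x)\<^sup>2)"
          unfolding E_def W_def using super_Poincare[OF L s] P \<beta>
          by (intro martingale_energy) (auto simp: \<beta>_def)
        \<comment> \<open>The energy of W is dropped, being nonnegative, and off J one factor of the
          squared influence is replaced by \<delta>.\<close>
        also have "\<dots> \<le> s * (\<Sum>j\<in>set L. 2 * I j) + \<beta> * (\<Sum>i\<in>set P. \<delta> * I i)"
        proof (intro add_mono mult_left_mono sum_mono)
          fix j assume j: "j \<in> set L"
          have "0 \<le> avgs L (var j W) x" unfolding avgs_var[OF j] by (intro avgs_nonneg) simp
          then show "avgs L (var j G) x - avgs L (var j W) x \<le> 2 * I j" using varG[OF j] by linarith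
        next
          fix i assume i: "i \<in> set P"
          have "0 \<le> infl L i G x" unfolding infl_def by (intro avgs_nonneg) (simp add: av_def sum_nonneg)
          moreover have "infl L i G x \<le> I i" using i P by (intro inflG) auto
          moreover have "I i \<le> \<delta>" using i P by (auto simp: J_def)
          ultimately show "(infl L i G x)\<^sup>2 \<le> \<delta> * I i"
            unfolding power2_eq_square by (intro mult_mono) auto
        qed (use s \<beta> in auto)
        also have "\<dots> \<le> s * (2 * K) + \<beta> * (\<delta> * K)"
        proof -
          have "(\<Sum>i\<in>set P. I i) \<le> (\<Sum>i\<in>set L. I i)" using P by (intro sum_mono2) (auto simp: I_nn)
          moreover have "(\<Sum>i\<in>set L. I i) \<le> K" using K by (simp add: I_def)
          ultimately have "(\<Sum>j\<in>set L. 2 * I j) \<le> 2 * K" "(\<Sum>i\<in>set P. \<delta> * I i) \<le> \<delta> * K"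
            using \<delta> by (simp_all add: sum_distrib_left[symmetric])
          then show ?thesis using s \<beta> by (intro add_mono mult_left_mono) auto
        qed
        finally show ?thesis .
      qed
      have "E (\<lambda>y. \<bar>F y - g y\<bar>)
          \<le> E (\<lambda>y. T * (G y - W y)\<^sup>2 + 3 / (4 * T) * (1 + (G y)\<^sup>2 + (W y)\<^sup>2))"
        unfolding E_def
      proof (rule avgs_mono)
        fix y
        \<comment> \<open>p is small in L2 and q bounded in L2; p q <= T p^2 + q^2 / (4 T) separates
          them.\<close>
        define p q where "p = \<bar>G y - W y\<bar>" "q = 1 + \<bar>G y\<bar> + \<bar>W y\<bar>"
        have "\<bar>F y - g y\<bar> = \<bar>quad (G y) - quad (W y)\<bar>" by (simp add: g_def qG)
        also have "\<dots> \<le> p * q" unfolding p_q_def by (rule quad_diff_le)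
        also have "\<dots> \<le> T * p\<^sup>2 + 1 / (4 * T) * q\<^sup>2"
        proof -
          have "0 \<le> (2 * T * p - q)\<^sup>2 / (4 * T)" using T by simp
          also have "\<dots> = T * p\<^sup>2 + 1 / (4 * T) * q\<^sup>2 - p * q"
            using T by (simp add: field_simps power2_eq_square)
          finally show ?thesis by simp
        qed
        also have "q\<^sup>2 \<le> 3 * (1 + (G y)\<^sup>2 + (W y)\<^sup>2)"
        proof -
          have "(1 + a + b)\<^sup>2 \<le> 3 * (1 + a\<^sup>2 + b\<^sup>2)" for a b :: real
          proof -
            have "0 \<le> (1 - a)\<^sup>2 + (1 - b)\<^sup>2 + (a - b)\<^sup>2" by simp
            then show ?thesis by (simp add: power2_eq_square algebra_simps)
          qed
          from this[of "\<bar>G y\<bar>" "\<bar>W y\<bar>"] show ?thesis by (simp add: p_q_def)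
        qed
        finally show "\<bar>F y - g y\<bar> \<le> T * (G y - W y)\<^sup>2 + 3 / (4 * T) * (1 + (G y)\<^sup>2 + (W y)\<^sup>2)"
          using T by (simp add: p_q_def divide_right_mono)
      qed
      also have "\<dots> = T * E (\<lambda>y. (G y - W y)\<^sup>2) + 3 / (4 * T) * (1 + E (\<lambda>y. (G y)\<^sup>2) + E (\<lambda>y. (W y)\<^sup>2))"
        unfolding E_def avgs_add avgs_cmult avgs_const ..
      also have "\<dots> \<le> T * (s * (2 * K) + \<beta> * (\<delta> * K)) + 3 / (4 * T) * (1 + K + K)"
        using EGW EG EW T by (intro add_mono mult_left_mono) auto
      also have "3 / (4 * T) * (1 + K + K) = \<epsilon> / 2"
        using assms by (simp add: T_def field_simps)
      finally show ?thesis using sT \<delta>T by (simp add: E_def distrib_left)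
    qed
    ultimately show "\<exists>J\<subseteq>set L. real (card J) \<le> K / \<delta> + 1 \<and>
        (\<exists>g. (\<forall>y z. (\<forall>k. k \<notin> set L - J \<longrightarrow> y k = z k) \<longrightarrow> g y = g z) \<and>
          avgs L (\<lambda>y. \<bar>F y - g y\<bar>) x \<le> \<epsilon>)" by (intro exI[of _ J] exI[of _ g] conjI)
  qed
qed

end

section \<open>Strongly log-concave measures on the line\<close>

locale strongly_log_concave =
  fixes v :: "real \<Rightarrow> real" and c :: real
  assumes c_pos: "c > 0"
    and smooth: "twice_cont_diff v"
    and convex: "\<And>x. deriv (deriv v) x \<ge> c"
    and prob: "prob_space (exp_density_measure v)"
begin

abbreviation "M \<equiv> exp_density_measure v"

definition \<rho> :: "real \<Rightarrow> real" where "\<rho> r = exp (- v r)"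

lemma \<rho>_pos: "\<rho> r > 0" by (simp add: \<rho>_def)

lemma DERIV_v: "(v has_real_derivative deriv v x) (at x)"
  using smooth by (simp add: twice_cont_diff_def DERIV_deriv_iff_real_differentiable)

lemma DERIV_v': "(deriv v has_real_derivative deriv (deriv v) x) (at x)"
  using smooth by (simp add: twice_cont_diff_def DERIV_deriv_iff_real_differentiable)

lemma borel_measurable_\<rho> [measurable]: "\<rho> \<in> borel_measurable borel"
proof -
  have "continuous_on UNIV v"
    using DERIV_v by (intro DERIV_continuous_on[of UNIV v "deriv v"]) (auto intro: has_field_derivative_at_within)
  then show ?thesis unfolding \<rho>_def[abs_def]
    by (intro borel_measurable_continuous_onI continuous_intros)
qed

lemma M_eq: "M = density lborel (\<lambda>r. ennreal (\<rho> r))"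
  by (simp add: exp_density_measure_def \<rho>_def)

lemma sets_M [measurable_cong]: "sets M = sets borel"
  by (simp add: M_eq)

lemma space_M [simp]: "space M = UNIV"
  by (simp add: M_eq)

lemma real_distribution_M: "real_distribution M"
  using prob sets_M by (simp add: real_distribution_def real_distribution_axioms_def)

sublocale real_distribution M by (rule real_distribution_M)

text \<open>The function v - c x^2 / 2 is convex, hence lies above its tangents.\<close>

lemma v_quadratic_lower_bound: "v x + deriv v x * (y - x) + c / 2 * (y - x)\<^sup>2 \<le> v y"
proof -
  have "(deriv v x - c * x) * (y - x) \<le> (v y - c / 2 * y\<^sup>2) - (v x - c / 2 * x\<^sup>2)"
  proof (rule f''_imp_f'[where C = UNIV and f'' = "\<lambda>x. deriv (deriv v) x - c"])
    show "((\<lambda>x. v x - c / 2 * x\<^sup>2) has_real_derivative deriv v x - c * x) (at x)" for x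
      by (auto intro!: derivative_eq_intros DERIV_v)
    show "((\<lambda>x. deriv v x - c * x) has_real_derivative deriv (deriv v) x - c) (at x)" for x
      by (auto intro!: derivative_eq_intros DERIV_v')
  qed (use convex in auto)
  then show ?thesis by (simp add: algebra_simps power2_eq_square)
qed

lemma \<rho>_le: "\<rho> (r + y) \<le> \<rho> r * exp (- deriv v r * y - c / 2 * y\<^sup>2)"
  using v_quadratic_lower_bound[of r "r + y"] by (simp add: \<rho>_def exp_add[symmetric])

lemma nn_integral_exp_half_line:
  fixes \<theta> A :: real
  assumes "\<theta> > 0" "A \<ge> 0" "\<And>y. y \<ge> 0 \<Longrightarrow> h y \<le> A * exp (- \<theta> * y)"
  shows "(\<integral>\<^sup>+y. ennreal (h y) * indicator {0..} y \<partial>lborel) \<le> ennreal (A / \<theta>)"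
proof -
  have "((\<lambda>y. A * exp (- \<theta> * y)) has_integral A * (exp (- \<theta> * 0) / \<theta>)) {0..}"
    by (intro has_integral_mult_right has_integral_exp_minus_to_infinity assms)
  then have "(\<integral>\<^sup>+y. ennreal (A * exp (- \<theta> * y)) * indicator {0..} y \<partial>lborel) = ennreal (A / \<theta>)"
    using assms by (subst nn_integral_has_integral_lebesgue'[where I = "A / \<theta>"]) auto
  moreover have "(\<integral>\<^sup>+y. ennreal (h y) * indicator {0..} y \<partial>lborel)
      \<le> (\<integral>\<^sup>+y. ennreal (A * exp (- \<theta> * y)) * indicator {0..} y \<partial>lborel)"
    using assms by (intro nn_integral_mono) (auto simp: indicator_def intro!: ennreal_leI)
  ultimately show ?thesis by simp
qed

lemma emeasure_right_tail:
  "emeasure M {r..} = (\<integral>\<^sup>+y. ennreal (\<rho> (r + y)) * indicator {0..} y \<partial>lborel)"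
proof -
  have "emeasure M {r..} = (\<integral>\<^sup>+y. ennreal (\<rho> y) * indicator {r..} y \<partial>lborel)"
    by (simp add: M_eq emeasure_density)
  also have "\<dots> = (\<integral>\<^sup>+y. ennreal (\<rho> (r + y)) * indicator {0..} y \<partial>lborel)"
    by (subst nn_integral_real_affine[where c = 1 and t = r]) (auto simp: indicator_def intro!: nn_integral_cong)
  finally show ?thesis .
qed

lemma emeasure_left_tail:
  "emeasure M {..r} = (\<integral>\<^sup>+y. ennreal (\<rho> (r + - y)) * indicator {0..} y \<partial>lborel)"
proof -
  have "emeasure M {..r} = (\<integral>\<^sup>+y. ennreal (\<rho> y) * indicator {..r} y \<partial>lborel)"
    by (simp add: M_eq emeasure_density)
  also have "\<dots> = (\<integral>\<^sup>+y. ennreal (\<rho> (r + - y)) * indicator {0..} y \<partial>lborel)"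
    by (subst nn_integral_real_affine[where c = "- 1" and t = r]) (auto simp: indicator_def intro!: nn_integral_cong)
  finally show ?thesis .
qed

(* The case distinction is on whether the slope of v at r is large or small; in the latter case the
  whole mass 1 is controlled by the density at r. *)
lemma tail_or_density_bound:
  assumes l: "\<theta> > 0"
  shows "measure M {..r} \<le> \<rho> r / \<theta> \<or> measure M {r..} \<le> \<rho> r / \<theta>
    \<or> 1 \<le> 2 * exp ((\<theta> + 1)\<^sup>2 / (2 * c)) * \<rho> r"
proof -
  have m: "measure M A \<le> B" if "emeasure M A \<le> ennreal B" "B \<ge> 0" for A B
    using that by (simp add: measure_def enn2real_leI)
  consider "deriv v r \<ge> \<theta>" | "deriv v r \<le> - \<theta>" | "\<bar>deriv v r\<bar> \<le> \<theta>" by linarith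
  then show ?thesis
  proof cases
    case 1
    have "emeasure M {r..} \<le> ennreal (\<rho> r / \<theta>)" unfolding emeasure_right_tail
    proof (intro nn_integral_exp_half_line l)
      fix y :: real assume y: "y \<ge> 0"
      have "- deriv v r * y - c / 2 * y\<^sup>2 \<le> - \<theta> * y"
      proof -
        have "0 \<le> c / 2 * (y)\<^sup>2" using c_pos by simp
        then show ?thesis using mult_right_mono[OF 1 y] by linarith
      qed
      then show "\<rho> (r + y) \<le> \<rho> r * exp (- \<theta> * y)"
        using \<rho>_le[of r y] \<rho>_pos[of r] by (smt (verit) exp_le_cancel_iff mult_left_mono)
    qed (use \<rho>_pos[of r] in simp)
    then show ?thesis using m l \<rho>_pos[of r] by simp
  next
    case 2
    have "emeasure M {..r} \<le> ennreal (\<rho> r / \<theta>)" unfolding emeasure_left_tail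
    proof (intro nn_integral_exp_half_line l)
      fix y :: real assume y: "y \<ge> 0"
      have "- deriv v r * - y - c / 2 * (- y)\<^sup>2 \<le> - \<theta> * y"
      proof -
        have "0 \<le> c / 2 * (- y)\<^sup>2" using c_pos by simp
        then show ?thesis using mult_right_mono[OF 2 y] by linarith
      qed
      then show "\<rho> (r + - y) \<le> \<rho> r * exp (- \<theta> * y)"
        using \<rho>_le[of r "- y"] \<rho>_pos[of r] by (smt (verit) exp_le_cancel_iff mult_left_mono)
    qed (use \<rho>_pos[of r] in simp)
    then show ?thesis using m l \<rho>_pos[of r] by simp
  next
    case 3
    \<comment> \<open>The slope costs at most exp(\<theta> |y|). Using \<theta> + 1 in place of
      \<theta> when maximizing against the Gaussian factor leaves exp(- |y|) over, whose integral
      over each half-line is 1. So both tails are at most B, and together they carry mass 1.\<close>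
    define B where "B = exp ((\<theta> + 1)\<^sup>2 / (2 * c)) * \<rho> r"
    have B: "B \<ge> 0" using \<rho>_pos[of r] by (simp add: B_def)
    have le: "\<rho> (r + y) \<le> B * exp (- 1 * \<bar>y\<bar>)" for y
    proof -
      have "- deriv v r * y \<le> \<theta> * \<bar>y\<bar>"
      proof -
        have "- deriv v r * y \<le> \<bar>deriv v r\<bar> * \<bar>y\<bar>" by (metis abs_ge_self abs_minus_cancel abs_mult)
        also have "\<dots> \<le> \<theta> * \<bar>y\<bar>" using 3 by (intro mult_right_mono) auto
        finally show ?thesis .
      qed
      moreover have "(\<theta> + 1) * t - c / 2 * t\<^sup>2 \<le> (\<theta> + 1)\<^sup>2 / (2 * c)" for t
      proof -
        have "0 \<le> ((\<theta> + 1) - c * t)\<^sup>2 / (2 * c)" using c_pos by simp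
        also have "\<dots> = (\<theta> + 1)\<^sup>2 / (2 * c) - ((\<theta> + 1) * t - c / 2 * t\<^sup>2)"
          using c_pos by (simp add: field_simps power2_eq_square)
        finally show ?thesis by simp
      qed
      from this[of "\<bar>y\<bar>"] have "(\<theta> + 1) * \<bar>y\<bar> - c / 2 * y\<^sup>2 \<le> (\<theta> + 1)\<^sup>2 / (2 * c)" by simp
      ultimately have "- deriv v r * y - c / 2 * y\<^sup>2 \<le> (\<theta> + 1)\<^sup>2 / (2 * c) - 1 * \<bar>y\<bar>"
        by (simp add: algebra_simps)
      then have "\<rho> r * exp (- deriv v r * y - c / 2 * y\<^sup>2) \<le> \<rho> r * exp ((\<theta> + 1)\<^sup>2 / (2 * c) - 1 * \<bar>y\<bar>)"
        using \<rho>_pos[of r] by (intro mult_left_mono) auto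
      also have "\<rho> r * exp ((\<theta> + 1)\<^sup>2 / (2 * c) - 1 * \<bar>y\<bar>) = B * exp (- 1 * \<bar>y\<bar>)"
      proof -
        have "w * exp (a - 1 * t) = exp a * w * exp (- 1 * t)" for a t w :: real
          by (simp add: exp_diff exp_minus divide_inverse)
        then show ?thesis unfolding B_def .
      qed
      finally show ?thesis using \<rho>_le[of r y] by linarith
    qed
    have "emeasure M {r..} \<le> ennreal (B / 1)" unfolding emeasure_right_tail
    proof (intro nn_integral_exp_half_line B)
      show "\<rho> (r + y) \<le> B * exp (- 1 * y)" if "y \<ge> 0" for y using le[of y] that by simp
    qed simp
    moreover have "emeasure M {..r} \<le> ennreal (B / 1)" unfolding emeasure_left_tail
    proof (intro nn_integral_exp_half_line B)
      show "\<rho> (r + - y) \<le> B * exp (- 1 * y)" if "y \<ge> 0" for y using le[of "- y"] that by simp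
    qed simp
    ultimately have "measure M {r..} \<le> B" "measure M {..r} \<le> B" using m B by simp_all
    moreover have "measure M ({..r} \<union> {r..}) \<le> measure M {..r} + measure M {r..}"
      by (intro measure_Un_le) auto
    moreover have "{..r} \<union> {r..} = (UNIV :: real set)" by auto
    ultimately have "1 \<le> 2 * B" using prob_space by simp
    then show ?thesis by (simp add: B_def)
  qed
qed

section \<open>Cells of equal mass\<close>

text \<open>The density is positive everywhere. This makes the distribution function strictly
  increasing, so that its sublevel sets are half-lines.\<close>

lemma measure_M_Ioo_pos: "a < b \<Longrightarrow> measure M {a<..<b} > 0"
proof (rule ccontr)
  assume "a < b" "\<not> measure M {a<..<b} > 0"
  then have "measure M {a<..<b} = 0" using measure_nonneg[of M "{a<..<b}"] by linarith
  then have "{a<..<b} \<in> null_sets M" by (intro null_setsI) (auto simp: emeasure_eq_measure)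
  then have "AE x in lborel. x \<notin> {a<..<b}"
    unfolding M_eq by (subst (asm) null_sets_density_iff) (auto simp: \<rho>_pos less_imp_neq[symmetric] not_le)
  then have "{a<..<b} \<in> null_sets lborel" by (subst AE_iff_null_sets) auto
  then have "emeasure lborel {a<..<b} = 0" by auto
  then show False using \<open>a < b\<close> by simp
qed

lemma cdf_strict_mono: "a < b \<Longrightarrow> cdf M a < cdf M b"
proof -
  assume "a < b"
  have "0 < measure M {a<..<b}" by (rule measure_M_Ioo_pos) fact
  also have "\<dots> \<le> measure M {a<..b}" by (intro finite_measure_mono) auto
  also have "\<dots> = cdf M b - cdf M a" using cdf_diff_eq[OF \<open>a < b\<close>] by simp
  finally show ?thesis by simp
qed

lemma cdf_less_iff: "cdf M a < cdf M b \<longleftrightarrow> a < b"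
  using cdf_strict_mono[of a b] cdf_nondecreasing[of b a] by (cases "a < b") auto

lemma cdf_less_1: "cdf M t < 1"
  using cdf_strict_mono[of t "t + 1"] cdf_bounded_prob[of "t + 1"] by simp

lemma measure_M_singleton [simp]: "measure M {x} = 0"
proof -
  have "{x} \<in> null_sets M"
    unfolding M_eq
  proof (subst null_sets_density_iff, simp_all only: sets_lborel)
    have "AE y in lborel. y \<in> {x} \<longrightarrow> ennreal (\<rho> y) = 0"
      using AE_lborel_singleton[of x] by eventually_elim simp
    then show "{x} \<in> sets borel \<and> (AE y in lborel. y \<in> {x} \<longrightarrow> ennreal (\<rho> y) = 0)" by simp
  qed measurable
  then show ?thesis by (simp add: measure_eq_0_null_sets)
qed

lemma measure_M_lessThan: "measure M {..<q} = cdf M q"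
proof -
  have "measure M {..q} = measure M {..<q} + measure M {q}"
    by (subst finite_measure_Union[symmetric]) (auto intro!: arg_cong[of _ _ "measure M"])
  then show ?thesis by (simp add: cdf_def)
qed

text \<open>The probability integral transform: without atoms the distribution function is
  continuous, so for 0 < r < 1 a quantile q exists, and strict monotonicity identifies the set with
  the half-line below q.\<close>

lemma measure_cdf_less:
  assumes "0 \<le> r" "r \<le> 1"
  shows "measure M {t. cdf M t < r} = r"
proof -
  consider "r = 0" | "r = 1" | "0 < r" "r < 1" using assms by linarith
  then show ?thesis
  proof cases
    case 1
    then have "{t. cdf M t < r} = {}" using cdf_nonneg by (auto simp: not_less)
    then show ?thesis using 1 by simp
  next
    case 2
    then show ?thesis using prob_space by (simp add: cdf_less_1)
  next
    case 3
    obtain a where a: "cdf M a < r"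
      using order_tendstoD(2)[OF cdf_lim_at_bot 3(1)] by (auto simp: eventually_at_bot_linorder)
    obtain b where b: "r < cdf M b"
      using order_tendstoD(1)[OF cdf_lim_at_top_prob 3(2)] by (auto simp: eventually_at_top_linorder)
    have "a \<le> b" using a b cdf_less_iff[of a b] by simp
    then obtain q where q: "cdf M q = r"
      using IVT[of "cdf M" a r b] a b by (auto simp: isCont_cdf)
    then show ?thesis using measure_M_lessThan[of q] by (simp add: cdf_less_iff q[symmetric] lessThan_def)
  qed
qed

text \<open>The cells are the intervals between consecutive quantiles of order a / m. Since
  \<open>cdf M t < 1\<close> everywhere, the index m never occurs.\<close>

definition cell :: "nat \<Rightarrow> real \<Rightarrow> nat" where "cell m t = nat \<lfloor>real m * cdf M t\<rfloor>"

lemma cell_eq_iff: "cell m t = a \<longleftrightarrow> real a \<le> real m * cdf M t \<and> real m * cdf M t < real a + 1"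
proof -
  have "0 \<le> \<lfloor>real m * cdf M t\<rfloor>" by (simp add: cdf_nonneg)
  then have "cell m t = a \<longleftrightarrow> \<lfloor>real m * cdf M t\<rfloor> = int a" by (auto simp: cell_def)
  then show ?thesis by (simp add: floor_eq_iff)
qed

lemma cell_less: "m > 0 \<Longrightarrow> cell m t < m"
proof -
  assume "m > 0"
  then have "real m * cdf M t < real m" using cdf_less_1[of t] by simp
  moreover have "real (cell m t) \<le> real m * cdf M t" using cell_eq_iff by blast
  ultimately show ?thesis by linarith
qed

lemma cell_mono: "s \<le> t \<Longrightarrow> cell m s \<le> cell m t"
  unfolding cell_def by (intro nat_mono floor_mono mult_left_mono cdf_nondecreasing) auto

lemma borel_measurable_cdf [measurable]: "cdf M \<in> borel_measurable borel"
  by (intro borel_measurable_mono monoI cdf_nondecreasing)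

lemma measurable_cell [measurable]: "cell m \<in> borel \<rightarrow>\<^sub>M count_space UNIV"
  unfolding cell_def[abs_def] by measurable

lemma borel_measurable_cell [measurable]: "(\<lambda>t. real (cell m t)) \<in> borel_measurable borel"
  unfolding cell_def[abs_def] by measurable

lemma measure_cell:
  assumes "a < m"
  shows "measure M {t. cell m t = a} = 1 / real m"
proof -
  have m: "m > 0" using assms by simp
  have "{t. cell m t = a} = {t. cdf M t < real (a + 1) / real m} - {t. cdf M t < real a / real m}"
    using m by (auto simp: cell_eq_iff field_simps)
  also have "measure M \<dots> = real (a + 1) / real m - real a / real m"
    using assms measure_cdf_less[of "real (a + 1) / real m"] measure_cdf_less[of "real a / real m"]
    by (subst finite_measure_Diff) (auto simp: divide_right_mono elim!: order_less_le_trans)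
  finally show ?thesis using m by (simp add: field_simps)
qed

text \<open>A Cheeger-type condition at each point r. The third alternative suffices because no part
  of a cell has mass above 1 / m.\<close>

definition cell_constant :: "nat \<Rightarrow> real \<Rightarrow> bool" where
  "cell_constant m \<kappa> \<longleftrightarrow> (\<forall>r. measure M {..r} \<le> \<kappa> * \<rho> r \<or> measure M {r..} \<le> \<kappa> * \<rho> r \<or> 1 / real m \<le> \<kappa> * \<rho> r)"

section \<open>The L1 Poincare inequality inside the cells\<close>

lemma abs_diff_le_nn_integral_deriv:
  fixes \<phi> \<phi>' :: "real \<Rightarrow> real"
  assumes d: "\<And>x. (\<phi> has_real_derivative \<phi>' x) (at x)" and cont: "continuous_on UNIV \<phi>'" and st: "s \<le> t"
  shows "ennreal \<bar>\<phi> s - \<phi> t\<bar> \<le> (\<integral>\<^sup>+r. ennreal \<bar>\<phi>' r\<bar> * indicator {s..t} r \<partial>lborel)"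
proof -
  have c: "continuous_on {s..t} \<phi>'" using cont continuous_on_subset by blast
  have "(\<phi>' has_integral \<phi> t - \<phi> s) {s..t}"
    using d st by (intro fundamental_theorem_of_calculus)
      (auto simp: has_real_derivative_iff_has_vector_derivative[symmetric] intro: has_field_derivative_at_within)
  then have "\<bar>\<phi> t - \<phi> s\<bar> = norm (integral {s..t} \<phi>')" by (simp add: integral_unique)
  also have "\<dots> \<le> integral {s..t} (\<lambda>r. \<bar>\<phi>' r\<bar>)"
    using c by (intro integral_norm_bound_integral integrable_continuous_interval continuous_intros) auto
  finally have "ennreal \<bar>\<phi> s - \<phi> t\<bar> \<le> ennreal (integral {s..t} (\<lambda>r. \<bar>\<phi>' r\<bar>))"
    by (simp add: abs_minus_commute ennreal_leI)
  also have "\<dots> = (\<integral>\<^sup>+r. ennreal \<bar>\<phi>' r\<bar> * indicator {s..t} r \<partial>lborel)"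
    using c by (intro nn_integral_has_integral_lebesgue'[symmetric] integrable_integral
      integrable_continuous_interval continuous_intros) auto
  finally show ?thesis .
qed

text \<open>Write the difference as an integral of the derivative over the points r between s and t,
  and exchange the integrals. For fixed r the pairs s <= r <= t in one cell have mass |P| |Q|, where
  P and Q are the two parts into which r cuts its cell. One of these masses is at most \<kappa>
  times the density at r and the other at most 1 / m, which cancels the normalization m. The 2
  counts the two orders of s and t.\<close>

theorem cell_Poincare:
  fixes \<phi> \<phi>' :: "real \<Rightarrow> real"
  assumes d: "\<And>x. (\<phi> has_real_derivative \<phi>' x) (at x)" and cont: "continuous_on UNIV \<phi>'"
    and m: "m > 0" and \<kappa>: "\<kappa> \<ge> 0" "cell_constant m \<kappa>"
  shows "(\<integral>\<^sup>+s. \<integral>\<^sup>+t. of_nat m * indicator {t. cell m t = cell m s} t * ennreal \<bar>\<phi> s - \<phi> t\<bar> \<partial>M \<partial>M)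
    \<le> ennreal (2 * \<kappa>) * (\<integral>\<^sup>+r. ennreal \<bar>\<phi>' r\<bar> \<partial>M)"
proof -
  have [measurable]: "\<phi>' \<in> borel_measurable borel" using cont by (rule borel_measurable_continuous_onI)
  \<comment> \<open>\<open>b s t r\<close> says that r lies between s and t and that s and t share a
    cell. The form \<open>b_eq\<close>, with real comparisons only, is there for joint
    measurability.\<close>
  define b where "b = (\<lambda>s t r. indicator {s..t} r * indicator {t. cell m t = cell m s} t :: ennreal)"
  have b_eq: "b s t r = (if s \<le> r \<and> r \<le> t \<and> real (cell m t) = real (cell m s) then 1 else 0)" for s t r
    by (auto simp: b_def indicator_def)
  have [measurable]: "(\<lambda>x. b (f x) (g x) (h x)) \<in> borel_measurable N"
    if [measurable]: "f \<in> borel_measurable N" "g \<in> borel_measurable N" "h \<in> borel_measurable N" for f g h and N :: "'c measure"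
    unfolding b_eq by measurable
  interpret sigma_finite_measure M by unfold_locales
  interpret L: pair_sigma_finite lborel M by unfold_locales
  interpret L': pair_sigma_finite M lborel by unfold_locales
  have "(\<integral>\<^sup>+s. \<integral>\<^sup>+t. of_nat m * indicator {t. cell m t = cell m s} t * ennreal \<bar>\<phi> s - \<phi> t\<bar> \<partial>M \<partial>M)
      \<le> (\<integral>\<^sup>+s. \<integral>\<^sup>+t. \<integral>\<^sup>+r. of_nat m * ennreal \<bar>\<phi>' r\<bar> * (b s t r + b t s r) \<partial>lborel \<partial>M \<partial>M)"
  proof (intro nn_integral_mono)
    fix s t
    show "of_nat m * indicator {t. cell m t = cell m s} t * ennreal \<bar>\<phi> s - \<phi> t\<bar>
        \<le> (\<integral>\<^sup>+r. of_nat m * ennreal \<bar>\<phi>' r\<bar> * (b s t r + b t s r) \<partial>lborel)"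
    proof (cases "cell m t = cell m s")
      case True
      have "ennreal \<bar>\<phi> s - \<phi> t\<bar> \<le> (\<integral>\<^sup>+r. ennreal \<bar>\<phi>' r\<bar> * indicator {min s t..max s t} r \<partial>lborel)"
        using abs_diff_le_nn_integral_deriv[OF d cont, of s t] abs_diff_le_nn_integral_deriv[OF d cont, of t s]
        by (cases "s \<le> t") (auto simp: abs_minus_commute min_def max_def)
      also have "\<dots> \<le> (\<integral>\<^sup>+r. ennreal \<bar>\<phi>' r\<bar> * (b s t r + b t s r) \<partial>lborel)"
        using True by (intro nn_integral_mono mult_left_mono) (auto simp: b_eq indicator_def)
      finally have "of_nat m * ennreal \<bar>\<phi> s - \<phi> t\<bar> \<le> of_nat m * (\<integral>\<^sup>+r. ennreal \<bar>\<phi>' r\<bar> * (b s t r + b t s r) \<partial>lborel)"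
        by (rule mult_left_mono) simp
      then show ?thesis using True by (simp add: nn_integral_cmult mult.assoc)
    qed simp
  qed
  also have "\<dots> = (\<integral>\<^sup>+s. \<integral>\<^sup>+r. \<integral>\<^sup>+t. of_nat m * ennreal \<bar>\<phi>' r\<bar> * (b s t r + b t s r) \<partial>M \<partial>lborel \<partial>M)"
    by (intro nn_integral_cong L.Fubini') measurable
  also have "\<dots> = (\<integral>\<^sup>+r. \<integral>\<^sup>+s. \<integral>\<^sup>+t. of_nat m * ennreal \<bar>\<phi>' r\<bar> * (b s t r + b t s r) \<partial>M \<partial>M \<partial>lborel)"
    by (rule L.Fubini') measurable
  also have "\<dots> \<le> (\<integral>\<^sup>+r. ennreal (2 * \<kappa>) * (ennreal (\<rho> r) * ennreal \<bar>\<phi>' r\<bar>) \<partial>lborel)"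
  proof (intro nn_integral_mono)
    fix r
    define P where "P = {s. s \<le> r \<and> cell m s = cell m r}"
    define Q where "Q = {t. r \<le> t \<and> cell m t = cell m r}"
    have [measurable]: "P \<in> sets borel" "Q \<in> sets borel" unfolding P_def Q_def by measurable
    \<comment> \<open>Cell indices are monotone, so a point between two points of one cell lies in
      that cell; this factors the indicator.\<close>
    have bPQ: "b s t r = indicator P s * indicator Q t" for s t
      using cell_mono[of s r m] cell_mono[of r t m] by (auto simp: b_eq P_def Q_def indicator_def)
    have "(\<integral>\<^sup>+s. \<integral>\<^sup>+t. of_nat m * ennreal \<bar>\<phi>' r\<bar> * (b s t r + b t s r) \<partial>M \<partial>M)
        = of_nat m * ennreal \<bar>\<phi>' r\<bar> * (2 * (emeasure M P * emeasure M Q))"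
      unfolding bPQ by (simp add: nn_integral_cmult nn_integral_multc nn_integral_add mult.commute mult_2)
    also have "\<dots> = ennreal \<bar>\<phi>' r\<bar> * ennreal (2 * (real m * measure M P * measure M Q))"
      by (simp add: emeasure_eq_measure ennreal_of_nat_eq_real_of_nat ennreal_mult[symmetric] ennreal_numeral[symmetric] ac_simps
        del: ennreal_numeral)
    also have "\<dots> \<le> ennreal \<bar>\<phi>' r\<bar> * ennreal (2 * (\<kappa> * \<rho> r))"
    proof (rule mult_left_mono, rule ennreal_leI)
      have PQ: "measure M P \<le> 1 / m" "measure M Q \<le> 1 / m"
        unfolding measure_cell[OF cell_less[OF m], of r, symmetric]
        by (intro finite_measure_mono; auto simp: P_def Q_def)+
      have "measure M P \<le> measure M {..r}" "measure M Q \<le> measure M {r..}"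
        by (intro finite_measure_mono; auto simp: P_def Q_def)+
      with \<kappa>(2) PQ have "measure M P \<le> \<kappa> * \<rho> r \<or> measure M Q \<le> \<kappa> * \<rho> r"
        unfolding cell_constant_def by (meson order_trans)
      then have "measure M P * measure M Q \<le> \<kappa> * \<rho> r * (1 / m)"
      proof
        assume "measure M P \<le> \<kappa> * \<rho> r"
        then show ?thesis using PQ by (intro mult_mono) (auto intro: order_trans[OF measure_nonneg])
      next
        assume "measure M Q \<le> \<kappa> * \<rho> r"
        then have "measure M Q * measure M P \<le> \<kappa> * \<rho> r * (1 / m)"
          using PQ by (intro mult_mono) (auto intro: order_trans[OF measure_nonneg])
        then show ?thesis by (simp add: mult.commute)
      qed
      then show "2 * (real m * measure M P * measure M Q) \<le> 2 * (\<kappa> * \<rho> r)"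
        using m by (simp add: field_simps)
    qed simp
    also have "\<dots> = ennreal (2 * \<kappa>) * (ennreal (\<rho> r) * ennreal \<bar>\<phi>' r\<bar>)"
      using \<kappa> \<rho>_pos[of r] by (simp add: ennreal_mult[symmetric] ac_simps)
    finally show "(\<integral>\<^sup>+s. \<integral>\<^sup>+t. of_nat m * ennreal \<bar>\<phi>' r\<bar> * (b s t r + b t s r) \<partial>M \<partial>M)
        \<le> ennreal (2 * \<kappa>) * (ennreal (\<rho> r) * ennreal \<bar>\<phi>' r\<bar>)" .
  qed
  also have "\<dots> = ennreal (2 * \<kappa>) * (\<integral>\<^sup>+r. ennreal \<bar>\<phi>' r\<bar> \<partial>M)"
    by (simp add: nn_integral_cmult M_eq nn_integral_density)
  finally show ?thesis .
qed

text \<open>\<theta> is taken large enough for the two tail alternatives; the number of cells must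
  then be large enough for the density alternative, whose constant grows with \<theta>.\<close>

lemma cell_constant:
  assumes "\<theta> > 0" "2 * exp ((\<theta> + 1)\<^sup>2 / (2 * c)) \<le> \<kappa> * real m" "1 / \<theta> \<le> \<kappa>" "m > 0"
  shows "cell_constant m \<kappa>"
  unfolding cell_constant_def
proof
  fix r
  have "\<rho> r / \<theta> \<le> \<kappa> * \<rho> r" using mult_right_mono[OF assms(3), of "\<rho> r"] \<rho>_pos[of r] by simp
  moreover have "1 / real m \<le> \<kappa> * \<rho> r" if "1 \<le> 2 * exp ((\<theta> + 1)\<^sup>2 / (2 * c)) * \<rho> r"
  proof -
    have "1 \<le> \<kappa> * real m * \<rho> r" using that mult_right_mono[OF assms(2), of "\<rho> r"] \<rho>_pos[of r] by linarith
    then show ?thesis using assms(4) by (simp add: field_simps)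
  qed
  ultimately show "measure M {..r} \<le> \<kappa> * \<rho> r \<or> measure M {r..} \<le> \<kappa> * \<rho> r \<or> 1 / real m \<le> \<kappa> * \<rho> r"
    using tail_or_density_bound[OF assms(1), of r] by (meson order_trans)
qed

end

section \<open>Discretization of product spaces\<close>

text \<open>Only the equal masses of the cells matter here. The number of cells is a parameter so
  that a fine partition and the one-cell partition can be used side by side.\<close>

locale cell_space = prob_space M + grid m for M :: "'a measure" and m :: nat +
  fixes cell :: "'a \<Rightarrow> nat" and I :: "'i set"
  assumes space_M [simp]: "space M = UNIV"
    and measurable_cell [measurable]: "cell \<in> M \<rightarrow>\<^sub>M count_space UNIV"
    and cell_less: "cell t < m"
    and measure_cell: "a < m \<Longrightarrow> measure M {t. cell t = a} = 1 / real m"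
    and finite_I [simp]: "finite I"
begin

abbreviation "N \<equiv> Pi\<^sub>M I (\<lambda>_. M)"

sublocale P: product_prob_space "\<lambda>_::'i. M" I
  by (simp add: product_prob_space_def product_prob_space_axioms_def product_sigma_finite_def
    prob_space_axioms prob_space_imp_sigma_finite)

text \<open>The density with respect to M of the Markov kernel that resamples a point inside its own
  cell.\<close>

definition same_cell :: "'a \<Rightarrow> 'a \<Rightarrow> ennreal" where
  "same_cell s t = of_nat m * indicator {t. cell t = cell s} t"

definition cellv :: "('i \<Rightarrow> 'a) \<Rightarrow> 'i \<Rightarrow> nat" where "cellv x = (\<lambda>j. cell (x j))"

text \<open>A version of the conditional expectation given the cell of coordinate \<open>i\<close>,
  defined at every point and not only up to null sets, because the grid function is later read off
  at representatives. Where a section is not integrable the integral has its default value 0; by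
  \<open>integrable_section\<close> this is a null set.\<close>

definition cond_av :: "'i \<Rightarrow> (('i \<Rightarrow> 'a) \<Rightarrow> real) \<Rightarrow> ('i \<Rightarrow> 'a) \<Rightarrow> real" where
  "cond_av i f x = real m * (LINT t|M. indicator {t. cell t = cell (x i)} t * f (x(i := t)))"

definition L1_infl :: "'i \<Rightarrow> (('i \<Rightarrow> 'a) \<Rightarrow> real) \<Rightarrow> ennreal" where
  "L1_infl i f = (\<integral>\<^sup>+x. \<integral>\<^sup>+t. ennreal \<bar>f x - f (x(i := t))\<bar> \<partial>M \<partial>N)"

lemma measurable_update [measurable (raw)]:
  assumes "i \<in> I" "f \<in> K \<rightarrow>\<^sub>M N" "h \<in> K \<rightarrow>\<^sub>M M"
  shows "(\<lambda>x. (f x)(i := h x)) \<in> K \<rightarrow>\<^sub>M N"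
  using assms by (intro measurable_fun_upd[where J = I]) auto

lemma update_in_space: "i \<in> I \<Longrightarrow> x \<in> space N \<Longrightarrow> x(i := t) \<in> space N"
  by (auto simp: space_PiM PiE_def extensional_def)

lemma sets_cell [measurable]: "{t. cell t = a} \<in> sets M"
  using measurable_sets[OF measurable_cell, of "{a}"] by (simp add: vimage_def)

lemma same_cell_commute: "same_cell s t = same_cell t s"
  by (simp add: same_cell_def indicator_def eq_commute)

text \<open>Joint measurability comes from writing the kernel as a finite sum of indicators of
  squares.\<close>

lemma measurable_same_cell [measurable (raw)]:
  assumes [measurable]: "f \<in> K \<rightarrow>\<^sub>M M" "g \<in> K \<rightarrow>\<^sub>M M"
  shows "(\<lambda>x. same_cell (f x) (g x)) \<in> borel_measurable K"
proof -
  have "same_cell s t = (\<Sum>a<m. of_nat m * indicator {t. cell t = a} s * indicator {t. cell t = a} t)" for s t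
    using cell_less[of s]
    by (auto simp: same_cell_def indicator_def of_bool_def if_distrib cong: if_cong)
  then show ?thesis by (simp only:) measurable
qed

lemma nn_integral_same_cell: "(\<integral>\<^sup>+t. same_cell s t \<partial>M) = 1"
proof -
  have "(\<integral>\<^sup>+t. same_cell s t \<partial>M) = of_nat m * emeasure M {t. cell t = cell s}"
    unfolding same_cell_def by (subst nn_integral_cmult_indicator) auto
  also have "\<dots> = 1"
    using m_pos by (simp add: emeasure_eq_measure measure_cell cell_less ennreal_of_nat_eq_real_of_nat ennreal_mult[symmetric])
  finally show ?thesis .
qed

text \<open>Replacing one coordinate by an independent copy preserves the product measure. This
  stands in for Fubini in coordinate \<open>i\<close> throughout.\<close>

lemma nn_integral_resample:
  assumes "i \<in> I" and [measurable]: "f \<in> borel_measurable N"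
  shows "(\<integral>\<^sup>+x. f x \<partial>N) = (\<integral>\<^sup>+x. \<integral>\<^sup>+t. f (x(i := t)) \<partial>M \<partial>N)"
proof -
  have I: "insert i (I - {i}) = I" using assms by auto
  have ins: "(\<integral>\<^sup>+x. g x \<partial>N) = (\<integral>\<^sup>+x. \<integral>\<^sup>+t. g (x(i := t)) \<partial>M \<partial>Pi\<^sub>M (I - {i}) (\<lambda>_. M))"
    if "g \<in> borel_measurable N" for g
    using P.product_nn_integral_insert[of "I - {i}" i g, unfolded I] that by simp
  have "(\<lambda>x. \<integral>\<^sup>+t. f (x(i := t)) \<partial>M) \<in> borel_measurable N" using assms by measurable
  then show ?thesis by (simp add: ins[of f] ins[of "\<lambda>x. \<integral>\<^sup>+t. f (x(i := t)) \<partial>M"] emeasure_space_1[simplified])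
qed

text \<open>The kernel is symmetric with total mass 1, hence reversible, hence preserves the
  measure.\<close>

lemma nn_integral_cond_av:
  assumes i: "i \<in> I" and [measurable]: "h \<in> borel_measurable N"
  shows "(\<integral>\<^sup>+x. \<integral>\<^sup>+s. same_cell (x i) s * h (x(i := s)) \<partial>M \<partial>N) = (\<integral>\<^sup>+x. h x \<partial>N)"
proof -
  interpret pair_sigma_finite M M by unfold_locales
  note [measurable] = i
  have [measurable]: "(\<lambda>x. \<integral>\<^sup>+s. same_cell (x i) s * h (x(i := s)) \<partial>M) \<in> borel_measurable N"
    by measurable
  have "(\<integral>\<^sup>+x. \<integral>\<^sup>+s. same_cell (x i) s * h (x(i := s)) \<partial>M \<partial>N)
      = (\<integral>\<^sup>+x. \<integral>\<^sup>+t. \<integral>\<^sup>+s. same_cell t s * h (x(i := s)) \<partial>M \<partial>M \<partial>N)"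
    by (subst nn_integral_resample[OF i]) simp_all
  also have "\<dots> = (\<integral>\<^sup>+x. \<integral>\<^sup>+s. \<integral>\<^sup>+t. same_cell t s * h (x(i := s)) \<partial>M \<partial>M \<partial>N)"
    using i by (intro nn_integral_cong Fubini'[symmetric]) measurable
  also have "\<dots> = (\<integral>\<^sup>+x. \<integral>\<^sup>+s. h (x(i := s)) \<partial>M \<partial>N)"
    by (simp add: nn_integral_multc same_cell_commute[of _ s for s] nn_integral_same_cell)
  also have "\<dots> = (\<integral>\<^sup>+x. h x \<partial>N)" by (rule nn_integral_resample[OF i, symmetric]) simp
  finally show ?thesis .
qed

lemma integrable_section:
  fixes f :: "_ \<Rightarrow> real"
  assumes i: "i \<in> I" and f: "integrable N f"
  shows "AE x in N. integrable M (\<lambda>t. f (x(i := t)))"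
proof -
  note [measurable] = borel_measurable_integrable[OF f] i
  have "(\<integral>\<^sup>+x. \<integral>\<^sup>+t. ennreal (norm (f (x(i := t)))) \<partial>M \<partial>N) = (\<integral>\<^sup>+x. ennreal (norm (f x)) \<partial>N)"
    by (rule nn_integral_resample[OF i, symmetric]) simp
  also have "\<dots> < \<infinity>" using f by (simp add: integrable_iff_bounded)
  finally have "AE x in N. (\<integral>\<^sup>+t. ennreal (norm (f (x(i := t)))) \<partial>M) \<noteq> \<infinity>"
    by (intro nn_integral_PInf_AE) auto
  then show ?thesis using AE_space
    by eventually_elim (use i in \<open>auto simp: integrable_iff_bounded top.not_eq_extremum\<close>)
qed

text \<open>Needed for the influence in direction \<open>j\<close> of an \<open>i\<close>-average,
  which compares the \<open>i\<close>-sections at x and at \<open>x(j := t)\<close>.\<close>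

lemma integrable_section':
  fixes f :: "_ \<Rightarrow> real"
  assumes ij: "i \<in> I" "j \<in> I" and f: "integrable N f"
  shows "AE x in N. AE t in M. integrable M (\<lambda>s. f (x(j := t, i := s)))"
proof -
  note [measurable] = borel_measurable_integrable[OF f] ij
  have "(\<integral>\<^sup>+x. \<integral>\<^sup>+t. \<integral>\<^sup>+s. ennreal (norm (f (x(j := t, i := s)))) \<partial>M \<partial>M \<partial>N)
      = (\<integral>\<^sup>+x. \<integral>\<^sup>+s. ennreal (norm (f (x(i := s)))) \<partial>M \<partial>N)"
    by (rule nn_integral_resample[OF ij(2), symmetric]) measurable
  also have "\<dots> = (\<integral>\<^sup>+x. ennreal (norm (f x)) \<partial>N)"
    by (rule nn_integral_resample[OF ij(1), symmetric]) simp
  also have "\<dots> < \<infinity>" using f by (simp add: integrable_iff_bounded)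
  finally have "AE x in N. (\<integral>\<^sup>+t. \<integral>\<^sup>+s. ennreal (norm (f (x(j := t, i := s)))) \<partial>M \<partial>M) \<noteq> \<infinity>"
    by (intro nn_integral_PInf_AE) auto
  then show ?thesis using AE_space
  proof eventually_elim
    case (elim x)
    note [measurable] = elim(2)
    have "AE t in M. (\<integral>\<^sup>+s. ennreal (norm (f (x(j := t, i := s)))) \<partial>M) \<noteq> \<infinity>"
      using elim by (intro nn_integral_PInf_AE) auto
    then show ?case
      by eventually_elim (auto simp: integrable_iff_bounded top.not_eq_extremum)
  qed
qed

lemma borel_measurable_cond_av [measurable]:
  assumes i [measurable]: "i \<in> I" and [measurable]: "f \<in> borel_measurable N"
  shows "cond_av i f \<in> borel_measurable N"
proof -
  have "indicator {t. cell t = cell (x i)} t = enn2real (same_cell (x i) t) / real m" for x t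
    using m_pos by (auto simp: same_cell_def indicator_def)
  then show ?thesis unfolding cond_av_def[abs_def] by (simp only:) measurable
qed

text \<open>Two functions and two points, to serve three purposes: contraction (one point), the
  error (one function constant), and influences in another direction (one function).\<close>

lemma cond_av_diff_le:
  assumes "cell (x i) = cell (y i)"
    and "integrable M (\<lambda>t. f (x(i := t)))" "integrable M (\<lambda>t. g (y(i := t)))"
  shows "ennreal \<bar>cond_av i f x - cond_av i g y\<bar>
    \<le> (\<integral>\<^sup>+s. same_cell (x i) s * ennreal \<bar>f (x(i := s)) - g (y(i := s))\<bar> \<partial>M)"
proof -
  define S where "S = {t. cell t = cell (x i)}"
  have S: "S \<in> sets M" unfolding S_def by measurable
  have int: "integrable M (\<lambda>t. indicator S t * f (x(i := t)))" "integrable M (\<lambda>t. indicator S t * g (y(i := t)))"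
    using integrable_mult_indicator[OF S assms(2)] integrable_mult_indicator[OF S assms(3)] by simp_all
  have "cond_av i f x - cond_av i g y = (LINT t|M. real m * (indicator S t * f (x(i := t)) - indicator S t * g (y(i := t))))"
    using int by (simp add: cond_av_def S_def[symmetric] assms(1)[symmetric] right_diff_distrib)
  moreover have "ennreal (norm \<dots>) \<le> (\<integral>\<^sup>+t. norm (real m * (indicator S t * f (x(i := t)) - indicator S t * g (y(i := t)))) \<partial>M)"
    using int by (intro integral_norm_bound_ennreal) auto
  moreover have "\<dots> = (\<integral>\<^sup>+s. same_cell (x i) s * ennreal \<bar>f (x(i := s)) - g (y(i := s))\<bar> \<partial>M)"
    by (intro nn_integral_cong)
      (auto simp: same_cell_def S_def[symmetric] indicator_def abs_mult ennreal_mult ennreal_of_nat_eq_real_of_nat)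
  ultimately show ?thesis by simp
qed

lemma cond_av_L1_contraction:
  assumes i: "i \<in> I" and f: "integrable N f" and g: "integrable N g"
  shows "(\<integral>\<^sup>+x. ennreal \<bar>cond_av i f x - cond_av i g x\<bar> \<partial>N) \<le> (\<integral>\<^sup>+x. ennreal \<bar>f x - g x\<bar> \<partial>N)"
proof -
  note [measurable] = borel_measurable_integrable[OF f] borel_measurable_integrable[OF g] i
  have "(\<integral>\<^sup>+x. ennreal \<bar>cond_av i f x - cond_av i g x\<bar> \<partial>N)
      \<le> (\<integral>\<^sup>+x. \<integral>\<^sup>+s. same_cell (x i) s * ennreal \<bar>f (x(i := s)) - g (x(i := s))\<bar> \<partial>M \<partial>N)"
    using integrable_section[OF i f] integrable_section[OF i g]
    by (intro nn_integral_mono_AE, eventually_elim) (rule cond_av_diff_le, auto)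
  also have "\<dots> = (\<integral>\<^sup>+x. ennreal \<bar>f x - g x\<bar> \<partial>N)" by (rule nn_integral_cond_av[OF i]) simp
  finally show ?thesis .
qed

lemma integrable_cond_av:
  assumes i: "i \<in> I" and f: "integrable N f"
  shows "integrable N (cond_av i f)"
proof -
  have "cond_av i (\<lambda>_. 0) = (\<lambda>_. 0)" by (simp add: cond_av_def fun_eq_iff)
  then have "(\<integral>\<^sup>+x. ennreal \<bar>cond_av i f x\<bar> \<partial>N) \<le> (\<integral>\<^sup>+x. ennreal \<bar>f x\<bar> \<partial>N)"
    using cond_av_L1_contraction[OF i f, of "\<lambda>_. 0"] by simp
  also have "\<dots> < \<infinity>" using f by (simp add: integrable_iff_bounded)
  finally show ?thesis using i f by (simp add: integrable_iff_bounded borel_measurable_cond_av)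
qed

lemma cond_av_error:
  assumes i: "i \<in> I" and f: "integrable N f"
  shows "(\<integral>\<^sup>+x. ennreal \<bar>f x - cond_av i f x\<bar> \<partial>N)
    \<le> (\<integral>\<^sup>+x. \<integral>\<^sup>+s. same_cell (x i) s * ennreal \<bar>f x - f (x(i := s))\<bar> \<partial>M \<partial>N)"
proof (intro nn_integral_mono_AE)
  show "AE x in N. ennreal \<bar>f x - cond_av i f x\<bar>
      \<le> (\<integral>\<^sup>+s. same_cell (x i) s * ennreal \<bar>f x - f (x(i := s))\<bar> \<partial>M)"
    using integrable_section[OF i f]
  proof eventually_elim
    case (elim x)
    have "cond_av i (\<lambda>_. f x) x = f x"
      using m_pos by (simp add: cond_av_def measure_cell cell_less)
    then show ?case using cond_av_diff_le[of x i x "\<lambda>_. f x" f] elim by simp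
  qed
qed

lemma same_cell_le: "same_cell s t \<le> of_nat m"
  by (auto simp: same_cell_def indicator_def)

lemma cond_av_error_le_L1_infl:
  assumes i: "i \<in> I" and f: "integrable N f"
  shows "(\<integral>\<^sup>+x. ennreal \<bar>f x - cond_av i f x\<bar> \<partial>N) \<le> of_nat m * L1_infl i f"
proof -
  note [measurable] = borel_measurable_integrable[OF f] i
  have "(\<integral>\<^sup>+x. ennreal \<bar>f x - cond_av i f x\<bar> \<partial>N)
      \<le> (\<integral>\<^sup>+x. \<integral>\<^sup>+s. of_nat m * ennreal \<bar>f x - f (x(i := s))\<bar> \<partial>M \<partial>N)"
    by (intro order_trans[OF cond_av_error[OF i f]] nn_integral_mono mult_right_mono same_cell_le) simp
  also have "\<dots> = (\<integral>\<^sup>+x. of_nat m * (\<integral>\<^sup>+s. ennreal \<bar>f x - f (x(i := s))\<bar> \<partial>M) \<partial>N)"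
    by (intro nn_integral_cong nn_integral_cmult) measurable
  also have "\<dots> = of_nat m * L1_infl i f"
    unfolding L1_infl_def by (intro nn_integral_cmult) measurable
  finally show ?thesis .
qed

lemma L1_infl_cond_av_other:
  assumes ij: "i \<in> I" "j \<in> I" "i \<noteq> j" and f: "integrable N f"
  shows "L1_infl j (cond_av i f) \<le> L1_infl j f"
proof -
  interpret pair_sigma_finite M M by unfold_locales
  note [measurable] = borel_measurable_integrable[OF f] ij(1,2)
  have "L1_infl j (cond_av i f)
      \<le> (\<integral>\<^sup>+x. \<integral>\<^sup>+t. \<integral>\<^sup>+s. same_cell (x i) s * ennreal \<bar>f (x(i := s)) - f (x(i := s, j := t))\<bar> \<partial>M \<partial>M \<partial>N)"
    unfolding L1_infl_def
  proof (rule nn_integral_mono_AE)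
    show "AE x in N. (\<integral>\<^sup>+t. ennreal \<bar>cond_av i f x - cond_av i f (x(j := t))\<bar> \<partial>M)
      \<le> (\<integral>\<^sup>+t. \<integral>\<^sup>+s. same_cell (x i) s * ennreal \<bar>f (x(i := s)) - f (x(i := s, j := t))\<bar> \<partial>M \<partial>M)"
      using integrable_section[OF ij(1) f] integrable_section'[OF ij(1,2) f]
    proof eventually_elim
      case (elim x)
      from elim(2) have "AE t in M. ennreal \<bar>cond_av i f x - cond_av i f (x(j := t))\<bar>
          \<le> (\<integral>\<^sup>+s. same_cell (x i) s * ennreal \<bar>f (x(i := s)) - f (x(i := s, j := t))\<bar> \<partial>M)"
      proof eventually_elim
        case (elim t)
        then show ?case
          using cond_av_diff_le[of x i "x(j := t)" f f] \<open>integrable M (\<lambda>t. f (x(i := t)))\<close> ij(3)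
          by (simp add: fun_upd_twist[of i j])
      qed
      then show ?case by (rule nn_integral_mono_AE)
    qed
  qed
  also have "\<dots> = (\<integral>\<^sup>+x. \<integral>\<^sup>+s. \<integral>\<^sup>+t. same_cell (x i) s * ennreal \<bar>f (x(i := s)) - f (x(i := s, j := t))\<bar> \<partial>M \<partial>M \<partial>N)"
    using ij by (intro nn_integral_cong Fubini') measurable
  also have "\<dots> = (\<integral>\<^sup>+x. \<integral>\<^sup>+s. same_cell (x i) s * (\<integral>\<^sup>+t. ennreal \<bar>f (x(i := s)) - f (x(i := s, j := t))\<bar> \<partial>M) \<partial>M \<partial>N)"
    using ij by (intro nn_integral_cong nn_integral_cmult) measurable
  also have "\<dots> = L1_infl j f"
    unfolding L1_infl_def by (rule nn_integral_cond_av[OF ij(1)]) measurable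
  finally show ?thesis .
qed

text \<open>Triangle inequality, each endpoint costing one averaging error of at most m influences.
  The factor is harmless since m is fixed before the junta bound is invoked.\<close>

lemma L1_infl_cond_av_same:
  assumes i: "i \<in> I" and f: "integrable N f"
  shows "L1_infl i (cond_av i f) \<le> of_nat (1 + 2 * m) * L1_infl i f"
proof -
  note [measurable] = borel_measurable_integrable[OF f] i
  define D where "D = (\<lambda>x. ennreal \<bar>f x - cond_av i f x\<bar>)"
  have [measurable]: "D \<in> borel_measurable N" unfolding D_def by measurable
  have [measurable]: "(\<lambda>x. \<integral>\<^sup>+t. D (x(i := t)) \<partial>M) \<in> borel_measurable N"
      "(\<lambda>x. \<integral>\<^sup>+t. ennreal \<bar>f x - f (x(i := t))\<bar> \<partial>M) \<in> borel_measurable N"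
    by measurable
  have "L1_infl i (cond_av i f)
      \<le> (\<integral>\<^sup>+x. \<integral>\<^sup>+t. ennreal \<bar>f x - f (x(i := t))\<bar> + D x + D (x(i := t)) \<partial>M \<partial>N)"
    unfolding L1_infl_def
  proof (intro nn_integral_mono)
    show "ennreal \<bar>cond_av i f x - cond_av i f (x(i := t))\<bar> \<le> ennreal \<bar>f x - f (x(i := t))\<bar> + D x + D (x(i := t))" for x t
      unfolding D_def by (simp add: ennreal_plus[symmetric] del: ennreal_plus)
  qed
  also have "\<dots> = (\<integral>\<^sup>+x. (\<integral>\<^sup>+t. ennreal \<bar>f x - f (x(i := t))\<bar> \<partial>M) + D x + (\<integral>\<^sup>+t. D (x(i := t)) \<partial>M) \<partial>N)"
    by (intro nn_integral_cong) (subst nn_integral_add, measurable, subst nn_integral_add, measurable, simp add: emeasure_space_1[simplified])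
  also have "\<dots> = L1_infl i f + (\<integral>\<^sup>+x. D x \<partial>N) + (\<integral>\<^sup>+x. \<integral>\<^sup>+t. D (x(i := t)) \<partial>M \<partial>N)"
    unfolding L1_infl_def by (simp add: nn_integral_add)
  also have "(\<integral>\<^sup>+x. \<integral>\<^sup>+t. D (x(i := t)) \<partial>M \<partial>N) = (\<integral>\<^sup>+x. D x \<partial>N)"
    by (rule nn_integral_resample[OF i, symmetric]) simp
  also have "L1_infl i f + (\<integral>\<^sup>+x. D x \<partial>N) + (\<integral>\<^sup>+x. D x \<partial>N)
      \<le> L1_infl i f + of_nat m * L1_infl i f + of_nat m * L1_infl i f"
    unfolding D_def by (intro add_mono cond_av_error_le_L1_infl i f order_refl)
  also have "\<dots> = of_nat (1 + 2 * m) * L1_infl i f"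
    by (simp add: distrib_right mult_2 add.assoc)
  finally show ?thesis .
qed

section \<open>Averaging over the cells in all coordinates\<close>

definition cond_avs :: "'i list \<Rightarrow> (('i \<Rightarrow> 'a) \<Rightarrow> real) \<Rightarrow> ('i \<Rightarrow> 'a) \<Rightarrow> real" where
  "cond_avs L = foldr cond_av L"

lemma cond_avs_simps [simp]:
  "cond_avs [] f = f" "cond_avs (i # L) f = cond_av i (cond_avs L f)"
  by (simp_all add: cond_avs_def)

lemma integrable_cond_avs: "set L \<subseteq> I \<Longrightarrow> integrable N f \<Longrightarrow> integrable N (cond_avs L f)"
  by (induction L) (auto intro: integrable_cond_av)

text \<open>Telescoping with the L1 contraction, so each coordinate contributes the error of
  averaging f itself, not of a partly averaged function.\<close>

lemma cond_avs_error:
  assumes f: "integrable N f" and "set L \<subseteq> I" "distinct L"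
  shows "(\<integral>\<^sup>+x. ennreal \<bar>f x - cond_avs L f x\<bar> \<partial>N)
    \<le> (\<Sum>i\<in>set L. \<integral>\<^sup>+x. ennreal \<bar>f x - cond_av i f x\<bar> \<partial>N)"
  using assms(2,3)
proof (induction L)
  case (Cons i L)
  have i: "i \<in> I" and int: "integrable N (cond_avs L f)" using Cons.prems f by (auto intro: integrable_cond_avs)
  note [measurable] = borel_measurable_integrable[OF f] borel_measurable_integrable[OF int] i
  have "(\<integral>\<^sup>+x. ennreal \<bar>f x - cond_avs (i # L) f x\<bar> \<partial>N)
      \<le> (\<integral>\<^sup>+x. ennreal \<bar>f x - cond_av i f x\<bar> + ennreal \<bar>cond_av i f x - cond_av i (cond_avs L f) x\<bar> \<partial>N)"
    by (intro nn_integral_mono) (simp add: ennreal_plus[symmetric] del: ennreal_plus)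
  also have "\<dots> = (\<integral>\<^sup>+x. ennreal \<bar>f x - cond_av i f x\<bar> \<partial>N)
      + (\<integral>\<^sup>+x. ennreal \<bar>cond_av i f x - cond_av i (cond_avs L f) x\<bar> \<partial>N)"
    by (rule nn_integral_add) measurable
  also have "(\<integral>\<^sup>+x. ennreal \<bar>cond_av i f x - cond_av i (cond_avs L f) x\<bar> \<partial>N)
      \<le> (\<integral>\<^sup>+x. ennreal \<bar>f x - cond_avs L f x\<bar> \<partial>N)"
    by (rule cond_av_L1_contraction[OF i f int])
  also have "\<dots> \<le> (\<Sum>i\<in>set L. \<integral>\<^sup>+x. ennreal \<bar>f x - cond_av i f x\<bar> \<partial>N)"
    using Cons by simp
  finally show ?case using Cons.prems by (simp add: add_left_mono)
qed simp

text \<open>Averaging in the other coordinates does not increase an influence, and coordinate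
  \<open>j\<close> occurs at most once, so the factor does not compound with the dimension.\<close>

lemma L1_infl_cond_avs:
  assumes f: "integrable N f" and "set L \<subseteq> I" "distinct L" and j: "j \<in> I"
  shows "L1_infl j (cond_avs L f) \<le> (if j \<in> set L then of_nat (1 + 2 * m) else 1) * L1_infl j f"
  using assms(2,3)
proof (induction L)
  case (Cons i L)
  have i: "i \<in> I" "i \<notin> set L" and int: "integrable N (cond_avs L f)"
    using Cons.prems f by (auto intro: integrable_cond_avs)
  show ?case
  proof (cases "i = j")
    case True
    have "L1_infl j (cond_avs (i # L) f) \<le> of_nat (1 + 2 * m) * L1_infl j (cond_avs L f)"
      using L1_infl_cond_av_same[OF i(1) int] True by simp
    also have "\<dots> \<le> of_nat (1 + 2 * m) * L1_infl j f"
      using Cons True i by (intro mult_left_mono) auto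
    finally show ?thesis using True by simp
  next
    case False
    have "L1_infl j (cond_avs (i # L) f) \<le> L1_infl j (cond_avs L f)"
      using L1_infl_cond_av_other[OF i(1) j False int] by simp
    then show ?thesis using Cons False by (auto intro: order_trans)
  qed
qed simp

lemma cond_avs_cell_cong:
  assumes "distinct L" "j \<in> set L" "cell t = cell (x j)"
  shows "cond_avs L f (x(j := t)) = cond_avs L f x"
  using assms
proof (induction L arbitrary: x)
  case (Cons i L)
  show ?case
  proof (cases "i = j")
    case False
    have "cond_avs L f (x(i := s, j := t)) = cond_avs L f (x(i := s))" for s
      by (rule Cons.IH) (use Cons.prems False in auto)
    moreover have "x(j := t, i := s) = x(i := s, j := t)" for s
      by (rule fun_upd_twist) (use False in auto)
    ultimately show ?thesis using False unfolding cond_avs_simps cond_av_def by simp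
  next
    case True
    show ?thesis
      using Cons.prems unfolding cond_avs_simps cond_av_def True fun_upd_upd fun_upd_same by simp
  qed
qed simp

lemma cond_avs_cell_cong_all:
  assumes L: "distinct L" and "\<And>j. j \<in> set L \<Longrightarrow> cell (x j) = cell (y j)" "\<And>j. j \<notin> set L \<Longrightarrow> x j = y j"
  shows "cond_avs L f x = cond_avs L f y"
proof -
  \<comment> \<open>The points are exchanged one coordinate at a time through hybrids of x and
    y.\<close>
  have "cond_avs L f (override_on x y S) = cond_avs L f x" if "S \<subseteq> set L" "finite S" for S
    using that(2,1)
  proof (induction S rule: finite_induct)
    case (insert j S)
    then have eq: "override_on x y (insert j S) = (override_on x y S)(j := y j)" by (auto simp: override_on_def fun_eq_iff)
    have "cond_avs L f (override_on x y (insert j S)) = cond_avs L f (override_on x y S)"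
      unfolding eq using insert assms(2)[of j]
      by (intro cond_avs_cell_cong[OF L]) (auto simp: override_on_def)
    also have "\<dots> = cond_avs L f x" using insert by simp
    finally show ?case .
  qed simp
  from this[of "set L"] have "cond_avs L f (override_on x y (set L)) = cond_avs L f x" by simp
  moreover have "override_on x y (set L) = y" using assms(3) by (auto simp: override_on_def fun_eq_iff)
  ultimately show ?thesis by simp
qed

section \<open>Functions of the cell indices\<close>

text \<open>\<open>H\<close> is arbitrary. On the product space the indices outside \<open>I\<close>
  are constantly \<open>cell undefined\<close>, so \<open>cellv\<close> factors through a finite
  product of countable discrete spaces, which is discrete.\<close>

lemma measurable_cellv_comp [measurable]: "(\<lambda>x. H (cellv x)) \<in> N \<rightarrow>\<^sub>M count_space UNIV"
proof -
  define k where "k = (\<lambda>x. \<lambda>j\<in>I. cell (x j))"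
  have "k \<in> N \<rightarrow>\<^sub>M Pi\<^sub>M I (\<lambda>_. count_space UNIV)" unfolding k_def by measurable
  also have "Pi\<^sub>M I (\<lambda>_. count_space UNIV) = count_space (Pi\<^sub>E I (\<lambda>_. UNIV :: nat set))"
    by (rule count_space_PiM_finite) auto
  finally have k [measurable]: "k \<in> N \<rightarrow>\<^sub>M count_space (Pi\<^sub>E I (\<lambda>_. UNIV))" .
  have "(\<lambda>x. H (\<lambda>j. if j \<in> I then k x j else cell undefined)) \<in> N \<rightarrow>\<^sub>M count_space UNIV"
    by (rule measurable_compose[OF k]) simp
  also have "?this \<longleftrightarrow> ?thesis"
    by (intro measurable_cong arg_cong[of _ _ H]) (auto simp: k_def cellv_def space_PiM PiE_def extensional_def fun_eq_iff)
  finally show ?thesis .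
qed

lemma borel_measurable_cellv_comp [measurable]: "(\<lambda>x. H (cellv x) :: real) \<in> borel_measurable N"
  using measurable_compose[OF measurable_cellv_comp[of H], of "\<lambda>x. x" borel] by simp

lemma cellv_update: "cellv (x(i := t)) = (cellv x)(i := cell t)"
  by (auto simp: cellv_def)

lemma nn_integral_cell:
  fixes u :: "nat \<Rightarrow> real"
  assumes "\<And>a. 0 \<le> u a"
  shows "(\<integral>\<^sup>+t. ennreal (u (cell t)) \<partial>M) = ennreal ((\<Sum>a<m. u a) / real m)"
proof -
  have "(\<integral>\<^sup>+t. ennreal (u (cell t)) \<partial>M) = (\<integral>\<^sup>+t. (\<Sum>a<m. ennreal (u a) * indicator {t. cell t = a} t) \<partial>M)"
    using cell_less by (intro nn_integral_cong) (auto simp: indicator_def of_bool_def if_distrib cong: if_cong)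
  also have "\<dots> = (\<Sum>a<m. ennreal (u a) * emeasure M {t. cell t = a})"
    by (subst nn_integral_sum) (auto simp: nn_integral_cmult_indicator)
  also have "\<dots> = (\<Sum>a<m. ennreal (u a / real m))"
    using assms by (intro sum.cong) (auto simp: emeasure_eq_measure measure_cell ennreal_mult[symmetric])
  finally show ?thesis using assms by (simp add: sum_divide_distrib sum_ennreal)
qed

lemma nn_integral_cell_av:
  assumes "\<And>k. 0 \<le> H k"
  shows "(\<integral>\<^sup>+t. ennreal (H (cellv (x(i := t)))) \<partial>M) = ennreal (av i H (cellv x))"
  unfolding cellv_update av_def using assms by (rule nn_integral_cell)

text \<open>Averaging one coordinate at a time shows that the cell indices are uniform on the grid.
  The base point is forced: points of the product space are \<open>undefined\<close> outside
  \<open>I\<close>.\<close>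

lemma nn_integral_cellv:
  assumes "\<And>k. 0 \<le> H k" and L: "set L = I" and k: "k = (\<lambda>_. cell undefined)"
  shows "(\<integral>\<^sup>+x. ennreal (H (cellv x)) \<partial>N) = ennreal (avgs L H k)"
proof -
  have "(\<integral>\<^sup>+x. ennreal (H (cellv x)) \<partial>N) = (\<integral>\<^sup>+x. ennreal (avgs P H (cellv x)) \<partial>N)" if "set P \<subseteq> I" for P
    using that
  proof (induction P)
    case (Cons i P)
    have "(\<integral>\<^sup>+x. ennreal (H (cellv x)) \<partial>N) = (\<integral>\<^sup>+x. ennreal (avgs P H (cellv x)) \<partial>N)"
      using Cons by simp
    also have "\<dots> = (\<integral>\<^sup>+x. \<integral>\<^sup>+t. ennreal (avgs P H (cellv (x(i := t)))) \<partial>M \<partial>N)"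
      using Cons by (intro nn_integral_resample) auto
    also have "\<dots> = (\<integral>\<^sup>+x. ennreal (avgs (i # P) H (cellv x)) \<partial>N)"
      by (simp add: nn_integral_cell_av avgs_nonneg assms(1))
    finally show ?case .
  qed simp
  from this[of L] L have "(\<integral>\<^sup>+x. ennreal (H (cellv x)) \<partial>N) = (\<integral>\<^sup>+x. ennreal (avgs L H (cellv x)) \<partial>N)" by simp
  also have "\<dots> = (\<integral>\<^sup>+x. ennreal (avgs L H k) \<partial>N)"
    using L k by (intro nn_integral_cong arg_cong[of _ _ ennreal] avgs_cong_off)
      (auto simp: cellv_def space_PiM PiE_def extensional_def)
  also have "\<dots> = ennreal (avgs L H k)" by (simp add: P.emeasure_space_1)
  finally show ?thesis .
qed

theorem discretization:
  assumes f: "integrable N f" and L: "distinct L" "set L = I"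
  obtains F where
    "(\<integral>\<^sup>+x. ennreal \<bar>f x - F (cellv x)\<bar> \<partial>N) \<le> (\<Sum>i\<in>I. \<integral>\<^sup>+x. ennreal \<bar>f x - cond_av i f x\<bar> \<partial>N)"
    "\<And>i. i \<in> I \<Longrightarrow> ennreal (infl L i F (\<lambda>_. cell undefined)) \<le> of_nat (1 + 2 * m) * L1_infl i f"
proof -
  define h where "h = cond_avs L f"
  have int: "integrable N h" unfolding h_def using f L by (intro integrable_cond_avs) auto
  have "\<exists>t. cell t = a" if "a < m" for a
  proof (rule ccontr)
    assume "\<nexists>t. cell t = a"
    then have "{t. cell t = a} = {}" by auto
    then show False using measure_cell[OF that] that by simp
  qed
  then obtain r where r: "\<And>a. a < m \<Longrightarrow> cell (r a) = a" by metis
  \<comment> \<open>F evaluates the averaged function at a representative of each cell; cells have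
    positive mass, hence are nonempty, and the averaged function is constant on products of
    cells.\<close>
  define F where "F = (\<lambda>k. h (\<lambda>j. if j \<in> I then r (k j) else undefined))"
  have F: "F (cellv x) = h x" if "x \<in> space N" for x
    unfolding F_def h_def using that L
    by (intro cond_avs_cell_cong_all) (auto simp: cellv_def r cell_less space_PiM PiE_def extensional_def)
  show thesis
  proof (rule that)
    have "(\<integral>\<^sup>+x. ennreal \<bar>f x - F (cellv x)\<bar> \<partial>N) = (\<integral>\<^sup>+x. ennreal \<bar>f x - cond_avs L f x\<bar> \<partial>N)"
      by (intro nn_integral_cong) (simp add: F h_def)
    also have "\<dots> \<le> (\<Sum>i\<in>set L. \<integral>\<^sup>+x. ennreal \<bar>f x - cond_av i f x\<bar> \<partial>N)"
      using f L by (intro cond_avs_error) auto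
    finally show "(\<integral>\<^sup>+x. ennreal \<bar>f x - F (cellv x)\<bar> \<partial>N) \<le> (\<Sum>i\<in>I. \<integral>\<^sup>+x. ennreal \<bar>f x - cond_av i f x\<bar> \<partial>N)"
      using L by simp
  next
    fix i assume i: "i \<in> I"
    define H where "H = (\<lambda>k. av i (\<lambda>l. \<bar>F k - F l\<bar>) k)"
    have H_nn: "0 \<le> H k" for k unfolding H_def av_def by (intro divide_nonneg_nonneg sum_nonneg) auto
    have "ennreal (infl L i F (\<lambda>_. cell undefined)) = (\<integral>\<^sup>+x. ennreal (H (cellv x)) \<partial>N)"
      unfolding infl_def by (subst nn_integral_cellv[OF H_nn L(2) refl]) (simp add: H_def)
    also have "\<dots> = (\<integral>\<^sup>+x. \<integral>\<^sup>+t. ennreal \<bar>F (cellv x) - F (cellv (x(i := t)))\<bar> \<partial>M \<partial>N)"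
      unfolding H_def by (intro nn_integral_cong) (subst nn_integral_cell_av, auto)
    also have "\<dots> = L1_infl i h"
      unfolding L1_infl_def by (intro nn_integral_cong) (simp add: F update_in_space i)
    also have "\<dots> \<le> of_nat (1 + 2 * m) * L1_infl i f"
      unfolding h_def using L1_infl_cond_avs[OF f _ L(1) i] L i by simp
    finally show "ennreal (infl L i F (\<lambda>_. cell undefined)) \<le> of_nat (1 + 2 * m) * L1_infl i f" .
  qed
qed

end

section \<open>From the grid back to C1 functions\<close>

context strongly_log_concave begin

(* otherwise simp rewrites the index set {1..n} to {Suc 0..n} *)
declare One_nat_def [simp del]

lemma cell_space_cell:
  assumes "m > 0" "finite I"
  shows "cell_space M m (cell m) I"
proof -
  have "cell m \<in> M \<rightarrow>\<^sub>M count_space UNIV"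
    using measurable_cell by (simp add: measurable_cong_sets[OF sets_M refl])
  then show ?thesis
    using assms prob cell_less measure_cell
    by (simp add: cell_space_def cell_space_axioms_def grid_def)
qed

text \<open>The derivative is the pointwise limit of the difference quotients with step 1 / (k + 1),
  each measurable because f is.\<close>

lemma borel_measurable_partial_deriv:
  assumes f: "C1_on_Rn n f" "f \<in> borel_measurable (product_power n M)" and i: "i \<in> {1..n}"
  shows "partial_deriv i f \<in> borel_measurable (product_power n M)"
proof -
  interpret cell_space M 1 "cell 1" "{1..n}" by (rule cell_space_cell) auto
  have N: "product_power n M = N" by (simp add: product_power_def)
  note [measurable] = f(2)[unfolded N] i
  have [measurable]: "(\<lambda>t. t + a) \<in> M \<rightarrow>\<^sub>M M" for a :: real
    unfolding measurable_cong_sets[OF sets_M sets_M] by measurable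
  define q where "q = (\<lambda>k x. (f (x(i := x i + 1 / real (Suc k))) - f x) / (1 / real (Suc k)))"
  have "q k \<in> borel_measurable N" for k unfolding q_def by measurable
  moreover have "(\<lambda>k. q k x) \<longlonglongrightarrow> partial_deriv i f x" if x: "x \<in> space N" for x
  proof -
    have "x \<in> Rn n" using x by (simp add: Rn_def space_PiM)
    then have "((\<lambda>t. f (x(i := t))) has_real_derivative partial_deriv i f x) (at (x i))"
      using f(1) i by (auto simp: C1_on_Rn_def partial_deriv_def DERIV_deriv_iff_real_differentiable)
    then have "((\<lambda>h. (f (x(i := x i + h)) - f (x(i := x i))) / h) \<longlongrightarrow> partial_deriv i f x) (at 0)"
      by (simp add: DERIV_def)
    moreover have "filterlim (\<lambda>k. 1 / real (Suc k)) (at 0) sequentially"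
      by (rule filterlim_atI) (use LIMSEQ_Suc[OF lim_1_over_n] in auto)
    ultimately have "(\<lambda>k. (f (x(i := x i + 1 / real (Suc k))) - f (x(i := x i))) / (1 / real (Suc k)))
        \<longlonglongrightarrow> partial_deriv i f x" by (rule filterlim_compose)
    then show ?thesis by (simp add: q_def)
  qed
  ultimately show ?thesis unfolding N by (rule borel_measurable_LIMSEQ_real[rotated])
qed

text \<open>Resampling coordinate \<open>i\<close> beforehand turns the left-hand side into a double
  integral over each line in direction \<open>i\<close>, where \<open>cell_Poincare\<close> applies;
  resampling again restores the L1 norm of the derivative.\<close>

lemma product_cell_Poincare:
  assumes f: "C1_on_Rn n f" "f \<in> borel_measurable (product_power n M)" and i: "i \<in> {1..n}"
    and m: "m > 0" and \<kappa>: "\<kappa> \<ge> 0" "cell_constant m \<kappa>"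
  shows "(\<integral>\<^sup>+x. \<integral>\<^sup>+s. of_nat m * indicator {t. cell m t = cell m (x i)} s * ennreal \<bar>f x - f (x(i := s))\<bar>
      \<partial>M \<partial>product_power n M)
    \<le> ennreal (2 * \<kappa>) * L1_norm (product_power n M) (partial_deriv i f)"
proof -
  interpret cell_space M m "cell m" "{1..n}" using m by (rule cell_space_cell) auto
  have N: "product_power n M = N" by (simp add: product_power_def)
  note [measurable] = f(2)[unfolded N] borel_measurable_partial_deriv[OF f i, unfolded N] i
  have [measurable]: "(\<lambda>x. \<integral>\<^sup>+s. same_cell (x i) s * ennreal \<bar>f x - f (x(i := s))\<bar> \<partial>M) \<in> borel_measurable N"
    by measurable
  have "(\<integral>\<^sup>+x. \<integral>\<^sup>+s. same_cell (x i) s * ennreal \<bar>f x - f (x(i := s))\<bar> \<partial>M \<partial>N)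
      = (\<integral>\<^sup>+x. \<integral>\<^sup>+t. \<integral>\<^sup>+s. same_cell t s * ennreal \<bar>f (x(i := t)) - f (x(i := s))\<bar> \<partial>M \<partial>M \<partial>N)"
    by (subst nn_integral_resample[OF i]) simp_all
  also have "\<dots> \<le> (\<integral>\<^sup>+x. ennreal (2 * \<kappa>) * (\<integral>\<^sup>+r. ennreal \<bar>partial_deriv i f (x(i := r))\<bar> \<partial>M) \<partial>N)"
  proof (rule nn_integral_mono)
    fix x assume "x \<in> space N"
    then have x: "x(i := t) \<in> Rn n" for t
      using i by (auto simp: Rn_def space_PiM PiE_def extensional_def)
    show "(\<integral>\<^sup>+t. \<integral>\<^sup>+s. same_cell t s * ennreal \<bar>f (x(i := t)) - f (x(i := s))\<bar> \<partial>M \<partial>M)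
        \<le> ennreal (2 * \<kappa>) * (\<integral>\<^sup>+r. ennreal \<bar>partial_deriv i f (x(i := r))\<bar> \<partial>M)"
      unfolding same_cell_def
    proof (rule cell_Poincare[OF _ _ m \<kappa>])
      show "((\<lambda>t. f (x(i := t))) has_real_derivative partial_deriv i f (x(i := t))) (at t)" for t
      proof -
        have "(\<lambda>s. f ((x(i := t))(i := s))) differentiable (at ((x(i := t)) i))"
          using f(1) i x[of t] unfolding C1_on_Rn_def by blast
        then show ?thesis by (simp add: partial_deriv_def DERIV_deriv_iff_real_differentiable)
      qed
      have upd: "continuous_on UNIV (\<lambda>r. x(i := r))"
      proof (rule continuous_on_coordinatewise_then_product)
        show "continuous_on UNIV (\<lambda>r. (x(i := r)) j)" for j by (cases "j = i") auto
      qed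
      have "continuous_on (Rn n) (partial_deriv i f)"
        using f(1) i unfolding C1_on_Rn_def by blast
      then show "continuous_on UNIV (\<lambda>r. partial_deriv i f (x(i := r)))"
        by (rule continuous_on_compose2[OF _ upd]) (use x in blast)
    qed
  qed
  also have "\<dots> = ennreal (2 * \<kappa>) * (\<integral>\<^sup>+x. \<integral>\<^sup>+r. ennreal \<bar>partial_deriv i f (x(i := r))\<bar> \<partial>M \<partial>N)"
    by (rule nn_integral_cmult) measurable
  also have "(\<integral>\<^sup>+x. \<integral>\<^sup>+r. ennreal \<bar>partial_deriv i f (x(i := r))\<bar> \<partial>M \<partial>N) = L1_norm N (partial_deriv i f)"
    unfolding L1_norm_def by (rule nn_integral_resample[OF i, symmetric]) simp
  finally show ?thesis unfolding N same_cell_def .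
qed

text \<open>The grid theorem appears as the assumption \<open>junta\<close>, so that C can be fixed
  before v, n and f. Half of \<epsilon> pays for the discretization, half for the junta on the
  grid.\<close>

lemma approximation_by_junta:
  fixes \<epsilon> K \<kappa> \<kappa>\<^sub>1 :: real
  assumes f: "C1_on_Rn n f" "in_L2 (product_power n M) f" "total_influence n M f \<le> ennreal K" "K \<ge> 0"
    and m: "m > 0" and \<kappa>: "\<kappa> \<ge> 0" "cell_constant m \<kappa>" "2 * \<kappa> * K \<le> \<epsilon> / 2"
    and \<kappa>\<^sub>1: "\<kappa>\<^sub>1 \<ge> 0" "cell_constant 1 \<kappa>\<^sub>1"
    and junta: "\<And>(L :: nat list) F x. distinct L \<Longrightarrow> (\<Sum>i\<in>set L. grid.infl m L i F x) \<le> (1 + 2 * real m) * (2 * \<kappa>\<^sub>1 * K) \<Longrightarrow>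
      \<exists>J\<subseteq>set L. real (card J) \<le> C \<and>
        (\<exists>g. (\<forall>y z. (\<forall>k. k \<notin> set L - J \<longrightarrow> y k = z k) \<longrightarrow> g y = g z) \<and>
          grid.avgs m L (\<lambda>y. \<bar>F y - g y\<bar>) x \<le> \<epsilon> / 2)"
  shows "\<exists>g. g \<in> borel_measurable (product_power n M) \<and> depends_on_at_most n C g \<and>
    L1_norm (product_power n M) (\<lambda>x. f x - g x) \<le> ennreal \<epsilon>"
proof -
  interpret cell_space M m "cell m" "{1..n}" using m by (rule cell_space_cell) auto
  interpret one: cell_space M 1 "cell 1" "{1..n}" by (rule cell_space_cell) auto
  have N: "product_power n M = N" by (simp add: product_power_def)
  have fm [measurable]: "f \<in> borel_measurable N" and f2: "integrable N (\<lambda>x. (f x)\<^sup>2)"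
    using f(2) by (auto simp: in_L2_def N)
  have int: "integrable N f" using fm f2 by (rule P.square_integrable_imp_integrable)
  define D where "D = (\<lambda>i. L1_norm N (partial_deriv i f))"
  have D: "(\<Sum>i\<in>{1..n}. D i) \<le> ennreal K" using f(3) by (simp add: total_influence_def N D_def)
  have err: "(\<integral>\<^sup>+x. ennreal \<bar>f x - cond_av i f x\<bar> \<partial>N) \<le> ennreal (2 * \<kappa>) * D i" if "i \<in> {1..n}" for i
    using cond_av_error[OF that int] product_cell_Poincare[OF f(1) fm[folded N] that m \<kappa>(1,2)]
    by (simp add: N D_def same_cell_def)
  have infl_le: "L1_infl i f \<le> ennreal (2 * \<kappa>\<^sub>1) * D i" if "i \<in> {1..n}" for i
  proof -
    \<comment> \<open>With one cell the same-cell restriction is vacuous, and the cell inequality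
      bounds the full resampling influence.\<close>
    have "cell 1 t = 0" for t using one.cell_less[of t] by simp
    then show ?thesis
      using product_cell_Poincare[OF f(1) fm[folded N] that, of 1 \<kappa>\<^sub>1] \<kappa>\<^sub>1 by (simp add: N D_def L1_infl_def)
  qed
  define L where "L = [1..<Suc n]"
  have L: "distinct L" "set L = {1..n}" by (auto simp: L_def)
  obtain F where F1: "(\<integral>\<^sup>+x. ennreal \<bar>f x - F (cellv x)\<bar> \<partial>N) \<le> (\<Sum>i\<in>{1..n}. \<integral>\<^sup>+x. ennreal \<bar>f x - cond_av i f x\<bar> \<partial>N)"
    and F2: "\<And>i. i \<in> {1..n} \<Longrightarrow> ennreal (infl L i F (\<lambda>_. cell m undefined)) \<le> of_nat (1 + 2 * m) * L1_infl i f"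
    using discretization[OF int L] by blast
  define k where "k = (\<lambda>_::nat. cell m undefined)"
  have infl_nn: "0 \<le> infl L i F k" for i
    unfolding infl_def by (intro avgs_nonneg) (simp add: av_def sum_nonneg)
  have "ennreal (\<Sum>i\<in>set L. infl L i F k) = (\<Sum>i\<in>{1..n}. ennreal (infl L i F k))"
    using infl_nn L by (simp add: sum_ennreal)
  also have "\<dots> \<le> (\<Sum>i\<in>{1..n}. of_nat (1 + 2 * m) * (ennreal (2 * \<kappa>\<^sub>1) * D i))"
    using F2 infl_le unfolding k_def by (intro sum_mono) (meson mult_left_mono order_trans zero_le)
  also have "\<dots> = of_nat (1 + 2 * m) * (ennreal (2 * \<kappa>\<^sub>1) * (\<Sum>i\<in>{1..n}. D i))"
    by (simp add: sum_distrib_left)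
  also have "\<dots> \<le> of_nat (1 + 2 * m) * (ennreal (2 * \<kappa>\<^sub>1) * ennreal K)"
    by (intro mult_left_mono D) auto
  also have "\<dots> = ennreal ((1 + 2 * real m) * (2 * \<kappa>\<^sub>1 * K))"
    using \<kappa>\<^sub>1 f(4) unfolding ennreal_of_nat_eq_real_of_nat by (simp add: ennreal_mult)
  finally have "(\<Sum>i\<in>set L. infl L i F k) \<le> (1 + 2 * real m) * (2 * \<kappa>\<^sub>1 * K)"
    using \<kappa>\<^sub>1 f(4) by (subst (asm) ennreal_le_iff) auto
  from junta[OF L(1) this] obtain J g where J: "J \<subseteq> set L" "real (card J) \<le> C"
    and g: "\<And>y z. (\<And>k. k \<notin> set L - J \<Longrightarrow> y k = z k) \<Longrightarrow> g y = g z"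
    and gF: "avgs L (\<lambda>y. \<bar>F y - g y\<bar>) k \<le> \<epsilon> / 2" by blast
  have "depends_on_at_most n C (\<lambda>x. g (cellv x))"
    unfolding depends_on_at_most_def
  proof (intro exI[of _ J] conjI ballI impI)
    fix x y assume xy: "x \<in> Rn n" "y \<in> Rn n" "\<forall>i\<in>J. x i = y i"
    show "g (cellv x) = g (cellv y)"
      by (rule g) (use xy L in \<open>auto simp: cellv_def Rn_def PiE_def extensional_def\<close>)
  qed (use J L in auto)
  moreover have "L1_norm N (\<lambda>x. f x - g (cellv x)) \<le> ennreal \<epsilon>"
  proof -
    have "L1_norm N (\<lambda>x. f x - g (cellv x))
        \<le> (\<integral>\<^sup>+x. ennreal \<bar>f x - F (cellv x)\<bar> + ennreal \<bar>F (cellv x) - g (cellv x)\<bar> \<partial>N)"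
      unfolding L1_norm_def by (intro nn_integral_mono) (simp add: ennreal_plus[symmetric] del: ennreal_plus)
    also have "\<dots> = (\<integral>\<^sup>+x. ennreal \<bar>f x - F (cellv x)\<bar> \<partial>N) + (\<integral>\<^sup>+x. ennreal \<bar>F (cellv x) - g (cellv x)\<bar> \<partial>N)"
      by (rule nn_integral_add) measurable
    also have "(\<integral>\<^sup>+x. ennreal \<bar>F (cellv x) - g (cellv x)\<bar> \<partial>N) = ennreal (avgs L (\<lambda>y. \<bar>F y - g y\<bar>) k)"
      by (rule nn_integral_cellv[where H = "\<lambda>y. \<bar>F y - g y\<bar>"]) (auto simp: L k_def)
    also have "(\<integral>\<^sup>+x. ennreal \<bar>f x - F (cellv x)\<bar> \<partial>N) \<le> ennreal (2 * \<kappa>) * (\<Sum>i\<in>{1..n}. D i)"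
      unfolding sum_distrib_left by (intro order_trans[OF F1] sum_mono err)
    also have "\<dots> \<le> ennreal (2 * \<kappa>) * ennreal K" by (intro mult_left_mono D) auto
    also have "\<dots> \<le> ennreal (\<epsilon> / 2)" using \<kappa> f(4) by (simp add: ennreal_mult[symmetric] ennreal_leI)
    also have "ennreal (avgs L (\<lambda>y. \<bar>F y - g y\<bar>) k) \<le> ennreal (\<epsilon> / 2)" by (intro ennreal_leI gF)
    also have "ennreal (\<epsilon> / 2) + ennreal (\<epsilon> / 2) = ennreal \<epsilon>"
    proof -
      have "0 \<le> 2 * \<kappa> * K" using \<kappa> f(4) by simp
      then have "0 \<le> \<epsilon>" using \<kappa>(3) by linarith
      then show ?thesis by (simp add: ennreal_plus[symmetric] del: ennreal_plus)
    qed
    finally show ?thesis by (simp add: add_mono)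
  qed
  ultimately show ?thesis unfolding N by (intro exI[of _ "\<lambda>x. g (cellv x)"] conjI) auto
qed

end

theorem theorem1p2:
  fixes \<epsilon> c K :: real
  assumes "\<epsilon> > 0" and "c > 0" and "K \<ge> 0"
  shows "\<exists>C::real. C > 0 \<and>
    (\<forall>n::nat. n \<ge> 1 \<longrightarrow>
      (\<forall>(v :: real \<Rightarrow> real) (f :: (nat \<Rightarrow> real) \<Rightarrow> real).
        twice_cont_diff v \<longrightarrow>
        (\<forall>x. deriv (deriv v) x \<ge> c) \<longrightarrow>
        prob_space (exp_density_measure v) \<longrightarrow>
        C1_on_Rn n f \<longrightarrow>
        in_L2 (product_power n (exp_density_measure v)) f \<longrightarrow>
        total_influence n (exp_density_measure v) f \<le> ennreal K \<longrightarrow>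
        (\<exists>g :: (nat \<Rightarrow> real) \<Rightarrow> real.
          g \<in> borel_measurable (product_power n (exp_density_measure v)) \<and>
          depends_on_at_most n C g \<and>
          L1_norm (product_power n (exp_density_measure v)) (\<lambda>x. f x - g x) \<le> ennreal \<epsilon>)))"
proof -
  \<comment> \<open>\<kappa> makes the discretization error \<open>2 * \<kappa> * K\<close> at most
    \<epsilon> / 2. B is what \<open>cell_constant\<close> asks of \<kappa> m for \<theta> = 1 /
    \<kappa>, and \<open>\<kappa>\<^sub>1\<close> satisfies both of its demands for \<theta> = 1 and
    a single cell.\<close>
  define \<kappa> where "\<kappa> = \<epsilon> / (4 * (K + 1))"
  define \<kappa>\<^sub>1 where "\<kappa>\<^sub>1 = 1 + 2 * exp ((1 + 1)\<^sup>2 / (2 * c))"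
  define B where "B = 2 * exp ((1 / \<kappa> + 1)\<^sup>2 / (2 * c))"
  have \<kappa>: "\<kappa> > 0" using assms by (simp add: \<kappa>_def)
  have \<kappa>\<^sub>1: "\<kappa>\<^sub>1 \<ge> 0" by (simp add: \<kappa>\<^sub>1_def add_nonneg_nonneg)
  obtain m :: nat where "B / \<kappa> < real m" using reals_Archimedean2 by blast
  then have B: "B < \<kappa> * real m" using \<kappa> by (simp add: field_simps)
  moreover have "B > 0" by (simp add: B_def)
  ultimately have m: "m > 0" by (cases m) auto
  interpret grid m by standard (rule m)
  have \<epsilon>K: "\<epsilon> / 2 > 0" "(1 + 2 * real m) * (2 * \<kappa>\<^sub>1 * K) \<ge> 0" using assms \<kappa>\<^sub>1 by auto
  from junta_approximation[OF \<epsilon>K, where ?'i = nat] obtain C where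
    C: "C > 0 \<and> (\<forall>(L :: nat list) F x. distinct L \<longrightarrow>
      (\<Sum>i\<in>set L. infl L i F x) \<le> (1 + 2 * real m) * (2 * \<kappa>\<^sub>1 * K) \<longrightarrow>
      (\<exists>J\<subseteq>set L. real (card J) \<le> C \<and>
        (\<exists>g. (\<forall>y z. (\<forall>k. k \<notin> set L - J \<longrightarrow> y k = z k) \<longrightarrow> g y = g z) \<and>
          avgs L (\<lambda>y. \<bar>F y - g y\<bar>) x \<le> \<epsilon> / 2)))"
    by (rule exE) (rule that)
  have \<kappa>K: "2 * \<kappa> * K \<le> \<epsilon> / 2"
  proof -
    have "2 * (\<epsilon> / (4 * k)) * K = \<epsilon> / 2 * (K / k)" for k by simp
    then have "2 * \<kappa> * K = \<epsilon> / 2 * (K / (K + 1))" unfolding \<kappa>_def .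
    also have "\<dots> \<le> \<epsilon> / 2 * 1" using assms by (intro mult_left_mono) auto
    finally show ?thesis by simp
  qed
  show ?thesis
  proof (intro exI[of _ C] conjI C[THEN conjunct1] allI impI)
    fix n :: nat and v :: "real \<Rightarrow> real" and f :: "(nat \<Rightarrow> real) \<Rightarrow> real"
    assume v: "twice_cont_diff v" "\<forall>x. deriv (deriv v) x \<ge> c" "prob_space (exp_density_measure v)"
      and f: "C1_on_Rn n f" "in_L2 (product_power n (exp_density_measure v)) f"
        "total_influence n (exp_density_measure v) f \<le> ennreal K"
    have "strongly_log_concave v c"
      unfolding strongly_log_concave_def using v \<open>c > 0\<close> by blast
    then interpret strongly_log_concave v c .
    have cm: "cell_constant m \<kappa>"
      using \<kappa> B m by (intro cell_constant[of "1 / \<kappa>"]) (auto simp: B_def)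
    have c1: "cell_constant 1 \<kappa>\<^sub>1"
      by (intro cell_constant[of 1]) (auto simp: \<kappa>\<^sub>1_def)
    show "\<exists>g. g \<in> borel_measurable (product_power n (exp_density_measure v)) \<and>
        depends_on_at_most n C g \<and>
        L1_norm (product_power n (exp_density_measure v)) (\<lambda>x. f x - g x) \<le> ennreal \<epsilon>"
      by (rule approximation_by_junta[OF f \<open>K \<ge> 0\<close> m less_imp_le[OF \<kappa>] cm \<kappa>K \<kappa>\<^sub>1 c1
            C[THEN conjunct2, rule_format]])
  qed
qed

end
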